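(* Let $\Omega,\Omega_1,\Omega_2$ be minimal aperiodic tiling spaces in $\mathbb{R}^d$ with finite local complexity (FLC), let $h_1:\Omega\to\Omega_1$ be a homeomorphism and let $h_2:\Omega\to\Omega_2$ be a continuous map. If $[h_1]=[h_2]$ as elements of $\check H^1(\Omega;\mathbb{R}^d)$, then $h_2$ is homotopic to a composition $\phi\circ h_1$, where $\phi:\Omega_1\to\Omega_2$ is a local derivation.
   Context: **Tiling spaces.** A tile is a convex polytope in $\mathbb{R}^d$ with non-empty interior, possibly carrying a label in a compact metric space; the set of prototiles (tiles up to translation) is compact. A tiling is a collection of tiles covering $\mathbb{R}^d$, any two of which meet only along their boundaries. A Delone set is a uniformly discrete and relatively dense subset of $\mathbb{R}^d$, possibly labelled. Tilings and labelled Delone sets are used interchangeably. $\mathbb{R}^d$ acts by translation, $T\mapsto T-x$. The patch $T\cap B(x,R)$ is the set of labelled tiles meeting $B(x,R)$ (for Delone sets: labelled points in $B(x,R)$). Two tilings (Delone sets) are $\varepsilon$-close if on a ball of radius about $1/\varepsilon$ around the origin there is a one-to-one correspondence between their tiles (points), corresponding tiles being $\varepsilon$-close in Hausdorff distance (points being $\varepsilon$-close) with $\varepsilon$-close labels. A tiling space is a compact translation-invariant set of tilings (or labelled Delone sets). It is minimal if every $\mathbb{R}^d$-orbit is dense, aperiodic if $T-x=T$ implies $x=0$ for each of its elements, FLC if for each $R$ there are finitely many patches of radius $R$ up to translation. **Local derivation.** A factor map is a continuous onto map $\phi$ with $\phi(T-x)=\phi(T)-x$. A local derivation is a factor map such that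 for all $r>0$ there is $R>0$ with: $T\cap B(0,R)=T'\cap B(0,R)$ implies $\phi(T)\cap B(0,r)=\phi(T')\cap B(0,r)$. **FLC transversals.** The canonical transversal of a space of Delone sets is the set of its elements containing the origin. An FLC transversal of an FLC tiling space $\Omega$ is $\mathcal{D}^{-1}(\Xi')$, where $\mathcal{D}:\Omega\to\Omega_0$ is a local derivation to a space of Delone sets with canonical transversal $\Xi'$. A function on $\Omega$ is transversally locally constant if its restriction to every FLC transversal is locally constant. **Strong cohomology and fundamental class.** For $\Omega$ minimal, aperiodic, FLC, a strong 1-cocycle is a continuous $\alpha:\Omega\times\mathbb{R}^d\to\mathbb{R}^d$ with $\alpha(T,x)+\alpha(T-x,y)=\alpha(T,x+y)$ and with $\alpha(\cdot,v)$ transversally locally constant for each $v$; it is a strong coboundary if $\alpha(T,v)=s(T-v)-s(T)$ with $s:\Omega\to\mathbb{R}^d$ continuous and transversally locally constant. The quotient $H^1_s(\Omega;\mathbb{R}^d)$ is canonically isomorphic to $\check H^1(\Omega;\mathbb{R}^d)$: on an open flow box $U=\{S-x: S\in\Xi, |x|<\varepsilon\}$ ($\Xi$ an FLC transversal) put $c_U(S-x)=\alpha(S,x)$; the differences $c_U-c_V$ on overlaps are locally constant and form the Čech cocycle. The fundamental shape class $[\mathcal{F}(\Omega)]$ is the class of $\mathcal{F}(T,v)=v$. **Class of a map.** For a continuous map $f:\Omega\to\Omega'$ of FLC tiling spaces, $[f]:=f^*[\mathcal{F}(\Omega')]\in\check H^1(\Omega;\mathbb{R}^d)$, where $f^*$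 is pullback in Čech cohomology. *)

theory Defs
  imports "HOL-Analysis.Analysis"
begin

section \<open>Tilings and labelled Delone sets\<close>

text \<open>
  Tilings and labelled Delone sets are treated together: both are sets of pairs (support, label),
  where the support is a convex polytope in the case of tilings and a singleton \<open>{p}\<close> in the
  case of Delone sets. With this encoding "tiles meeting a ball" specialises to "points in the
  ball", and the Hausdorff distance of supports to the distance of points.
  Unlabelled objects are those with a constant label.
  The space $\mathbb{R}^d$ is an arbitrary Euclidean space \<open>'a\<close>.
\<close>

type_synonym ('a, 'l) tile = "'a set \<times> 'l"
type_synonym ('a, 'l) pattern = "('a, 'l) tile set"

definition hausdorff_dist :: "'a::metric_space set \<Rightarrow> 'a set \<Rightarrow> real" where
  "hausdorff_dist A B = max (SUP a\<in>A. infdist a B) (SUP b\<in>B. infdist b A)"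

definition tile_dist ::
    "('a::metric_space, 'l::metric_space) tile \<Rightarrow> ('a, 'l) tile \<Rightarrow> real" where
  "tile_dist t u = max (hausdorff_dist (fst t) (fst u)) (dist (snd t) (snd u))"

definition is_tile :: "('a::euclidean_space, 'l) tile \<Rightarrow> bool" where
  "is_tile t \<longleftrightarrow> polytope (fst t) \<and> interior (fst t) \<noteq> {}"

definition is_point :: "('a, 'l) tile \<Rightarrow> bool" where
  "is_point t \<longleftrightarrow> (\<exists>p. fst t = {p})"

definition is_tiling :: "('a::euclidean_space, 'l) pattern \<Rightarrow> bool" where
  "is_tiling T \<longleftrightarrow>
     (\<forall>t\<in>T. is_tile t) \<and> (\<Union>t\<in>T. fst t) = UNIV \<and>
     (\<forall>t\<in>T. \<forall>u\<in>T. t \<noteq> u \<longrightarrow> fst t \<inter> fst u \<subseteq> frontier (fst t) \<inter> frontier (fst u))"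

text \<open>Uniform discreteness is required for distinct \<^emph>\<open>labelled\<close> points, so that every point
  carries exactly one label.\<close>

definition is_delone :: "('a::euclidean_space, 'l) pattern \<Rightarrow> bool" where
  "is_delone T \<longleftrightarrow>
     (\<forall>t\<in>T. is_point t) \<and>
     (\<exists>r>0. \<forall>p l q m. ({p}, l) \<in> T \<longrightarrow> ({q}, m) \<in> T \<longrightarrow> (p, l) \<noteq> (q, m) \<longrightarrow> r \<le> dist p q) \<and>
     (\<exists>R>0. \<forall>x. \<exists>p l. ({p}, l) \<in> T \<and> dist x p \<le> R)"

text \<open>\<open>shift x T\<close> is $T - x$.\<close>

definition shift_tile :: "'a::ab_group_add \<Rightarrow> ('a, 'l) tile \<Rightarrow> ('a, 'l) tile" where
  "shift_tile x t = ((\<lambda>p. p - x) ` fst t, snd t)"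

definition shift :: "'a::ab_group_add \<Rightarrow> ('a, 'l) pattern \<Rightarrow> ('a, 'l) pattern" where
  "shift x T = shift_tile x ` T"

definition patch :: "('a::metric_space, 'l) pattern \<Rightarrow> 'a \<Rightarrow> real \<Rightarrow> ('a, 'l) pattern" where
  "patch T x R = {t \<in> T. fst t \<inter> ball x R \<noteq> {}}"


section \<open>Tiling spaces\<close>

text \<open>The one-to-one correspondence \<open>\<beta>\<close> must involve at least all tiles meeting the ball of radius
  $1/\varepsilon$, on both sides; tiles near the boundary of this ball may be matched with tiles
  just outside of it.\<close>

definition tiling_close ::
    "real \<Rightarrow> ('a::euclidean_space, 'l::metric_space) pattern \<Rightarrow> ('a, 'l) pattern \<Rightarrow> bool" where
  "tiling_close \<epsilon> T T' \<longleftrightarrow>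
     (\<exists>A A' \<beta>. patch T 0 (1 / \<epsilon>) \<subseteq> A \<and> A \<subseteq> T \<and> patch T' 0 (1 / \<epsilon>) \<subseteq> A' \<and> A' \<subseteq> T' \<and>
        bij_betw \<beta> A A' \<and> (\<forall>t\<in>A. tile_dist t (\<beta> t) < \<epsilon>))"

definition tiling_topology ::
    "('a::euclidean_space, 'l::metric_space) pattern set \<Rightarrow> ('a, 'l) pattern topology" where
  "tiling_topology \<Omega> =
     topology (\<lambda>U. U \<subseteq> \<Omega> \<and> (\<forall>T\<in>U. \<exists>\<epsilon>>0. \<forall>T'\<in>\<Omega>. tiling_close \<epsilon> T T' \<longrightarrow> T' \<in> U))"

text \<open>\<open>K\<close> is a compact set of prototiles; in particular the labels come from the compact set
  \<open>snd ` K\<close>. Tiling spaces are taken to be non-empty.\<close>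

definition tiling_space :: "('a::euclidean_space, 'l::metric_space) pattern set \<Rightarrow> bool" where
  "tiling_space \<Omega> \<longleftrightarrow>
     \<Omega> \<noteq> {} \<and>
     (\<exists>K. (Ball K is_tile \<and> Ball \<Omega> is_tiling \<or> Ball K is_point \<and> Ball \<Omega> is_delone) \<and>
          compact_space (Metric_space.mtopology K tile_dist) \<and>
          (\<forall>T\<in>\<Omega>. \<forall>t\<in>T. \<exists>k\<in>K. \<exists>x. t = shift_tile x k)) \<and>
     (\<forall>T\<in>\<Omega>. \<forall>x. shift x T \<in> \<Omega>) \<and>
     compact_space (tiling_topology \<Omega>)"

definition delone_space :: "('a::euclidean_space, 'l::metric_space) pattern set \<Rightarrow> bool" where
  "delone_space \<Omega> \<longleftrightarrow> tiling_space \<Omega> \<and> Ball \<Omega> is_delone"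

definition minimal :: "('a::euclidean_space, 'l::metric_space) pattern set \<Rightarrow> bool" where
  "minimal \<Omega> \<longleftrightarrow> (\<forall>T\<in>\<Omega>. tiling_topology \<Omega> closure_of (range (\<lambda>x. shift x T)) = \<Omega>)"

definition aperiodic :: "('a::ab_group_add, 'l) pattern set \<Rightarrow> bool" where
  "aperiodic \<Omega> \<longleftrightarrow> (\<forall>T\<in>\<Omega>. \<forall>x. shift x T = T \<longrightarrow> x = 0)"

definition FLC :: "('a::euclidean_space, 'l) pattern set \<Rightarrow> bool" where
  "FLC \<Omega> \<longleftrightarrow>
     (\<forall>R>0. \<exists>F. finite F \<and> (\<forall>T\<in>\<Omega>. \<forall>x. \<exists>P\<in>F. \<exists>y. patch T x R = shift y P))"


section \<open>Local derivations and FLC transversals\<close>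

definition factor_map ::
    "('a::euclidean_space, 'l::metric_space) pattern set \<Rightarrow> ('a, 'm::metric_space) pattern set \<Rightarrow>
     (('a, 'l) pattern \<Rightarrow> ('a, 'm) pattern) \<Rightarrow> bool" where
  "factor_map \<Omega> \<Omega>' \<phi> \<longleftrightarrow>
     continuous_map (tiling_topology \<Omega>) (tiling_topology \<Omega>') \<phi> \<and> \<phi> ` \<Omega> = \<Omega>' \<and>
     (\<forall>T\<in>\<Omega>. \<forall>x. \<phi> (shift x T) = shift x (\<phi> T))"

definition local_derivation ::
    "('a::euclidean_space, 'l::metric_space) pattern set \<Rightarrow> ('a, 'm::metric_space) pattern set \<Rightarrow>
     (('a, 'l) pattern \<Rightarrow> ('a, 'm) pattern) \<Rightarrow> bool" where
  "local_derivation \<Omega> \<Omega>' \<phi> \<longleftrightarrow>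
     factor_map \<Omega> \<Omega>' \<phi> \<and>
     (\<forall>r>0. \<exists>R>0. \<forall>T\<in>\<Omega>. \<forall>T'\<in>\<Omega>.
        patch T 0 R = patch T' 0 R \<longrightarrow> patch (\<phi> T) 0 r = patch (\<phi> T') 0 r)"

definition canonical_transversal :: "('a::zero, 'l) pattern set \<Rightarrow> ('a, 'l) pattern set" where
  "canonical_transversal \<Omega> = {T \<in> \<Omega>. \<exists>l. ({0}, l) \<in> T}"

text \<open>A definition cannot quantify over the label type of the Delone space \<open>\<Omega>0\<close>, so it is fixed to
  be that of \<open>\<Omega>\<close>. This is no restriction: making the labels of a Delone set constant is a local
  derivation and does not change the preimage of the canonical transversal.\<close>

definition FLC_transversal ::
    "('a::euclidean_space, 'l::metric_space) pattern set \<Rightarrow> ('a, 'l) pattern set \<Rightarrow> bool" where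
  "FLC_transversal \<Omega> \<Xi> \<longleftrightarrow>
     (\<exists>(\<Omega>0 :: ('a, 'l) pattern set) D. delone_space \<Omega>0 \<and> local_derivation \<Omega> \<Omega>0 D \<and>
        \<Xi> = {T \<in> \<Omega>. D T \<in> canonical_transversal \<Omega>0})"


section \<open>First Cech cohomology with coefficients in a discrete group\<close>

definition locally_constant_on :: "'x topology \<Rightarrow> 'x set \<Rightarrow> ('x \<Rightarrow> 'v) \<Rightarrow> bool" where
  "locally_constant_on X A f \<longleftrightarrow> continuous_map (subtopology X A) (discrete_topology UNIV) f"

text \<open>
  Following Godement, the direct limit over open covers is taken over the cofinal system of
  covers \<open>U\<close> indexed by the points of the space with \<open>x \<in> U x\<close>, ordered by pointwise
  inclusion. No refinement maps have to be chosen, and pullback along \<open>f\<close> sends the cover \<open>U\<close> to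
  \<open>x \<mapsto> f -` U (f x)\<close>. An element of $\check{H}^1$ is an equivalence class of pairs \<open>(U, g)\<close> of a
  cover and a cocycle on it, where \<open>g x y\<close> matters only on \<open>U x \<inter> U y\<close>.
\<close>

definition point_cover :: "'x topology \<Rightarrow> ('x \<Rightarrow> 'x set) \<Rightarrow> bool" where
  "point_cover X U \<longleftrightarrow> (\<forall>x\<in>topspace X. openin X (U x) \<and> x \<in> U x)"

type_synonym ('x, 'v) cech_cochain = "('x \<Rightarrow> 'x set) \<times> ('x \<Rightarrow> 'x \<Rightarrow> 'x \<Rightarrow> 'v)"

definition cech_cocycles :: "'x topology \<Rightarrow> ('x, 'v::ab_group_add) cech_cochain set" where
  "cech_cocycles X =
     {(U, g). point_cover X U \<and>
        (\<forall>x\<in>topspace X. \<forall>y\<in>topspace X. locally_constant_on X (U x \<inter> U y) (g x y)) \<and>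
        (\<forall>x\<in>topspace X. \<forall>y\<in>topspace X. \<forall>z\<in>topspace X. \<forall>p \<in> U x \<inter> U y \<inter> U z.
           g x y p + g y z p = g x z p)}"

text \<open>Two cocycles are identified if they differ by a coboundary on a common refinement \<open>W\<close>.\<close>

definition cech_rel ::
    "'x topology \<Rightarrow> (('x, 'v::ab_group_add) cech_cochain \<times> ('x, 'v) cech_cochain) set" where
  "cech_rel X =
     {((U, g), (V, h)). (U, g) \<in> cech_cocycles X \<and> (V, h) \<in> cech_cocycles X \<and>
        (\<exists>W s. point_cover X W \<and>
           (\<forall>x\<in>topspace X. W x \<subseteq> U x \<inter> V x \<and> locally_constant_on X (W x) (s x)) \<and>
           (\<forall>x\<in>topspace X. \<forall>y\<in>topspace X. \<forall>p \<in> W x \<inter> W y.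
              g x y p - h x y p = s x p - s y p))}"

definition cech_H1 :: "'x topology \<Rightarrow> ('x, 'v::ab_group_add) cech_cochain set set" where
  "cech_H1 X = cech_cocycles X // cech_rel X"

definition cocycle_pullback ::
    "'x topology \<Rightarrow> ('x \<Rightarrow> 'y) \<Rightarrow> ('y, 'v) cech_cochain \<Rightarrow> ('x, 'v) cech_cochain" where
  "cocycle_pullback X f = (\<lambda>(U, g).
     ((\<lambda>x. {p \<in> topspace X. f p \<in> U (f x)}), (\<lambda>x y p. g (f x) (f y) (f p))))"

definition cech_pullback ::
    "'x topology \<Rightarrow> ('x \<Rightarrow> 'y) \<Rightarrow> ('y, 'v::ab_group_add) cech_cochain set \<Rightarrow>
     ('x, 'v) cech_cochain set" where
  "cech_pullback X f \<kappa> = (\<Union>c\<in>\<kappa>. cech_rel X `` {cocycle_pullback X f c})"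


section \<open>Strong cocycles and the fundamental shape class\<close>

definition strong_cocycle ::
    "('a::euclidean_space, 'l::metric_space) pattern set \<Rightarrow> (('a, 'l) pattern \<Rightarrow> 'a \<Rightarrow> 'a) \<Rightarrow> bool" where
  "strong_cocycle \<Omega> \<alpha> \<longleftrightarrow>
     continuous_map (prod_topology (tiling_topology \<Omega>) euclidean) euclidean (\<lambda>(T, x). \<alpha> T x) \<and>
     (\<forall>T\<in>\<Omega>. \<forall>x y. \<alpha> T x + \<alpha> (shift x T) y = \<alpha> T (x + y)) \<and>
     (\<forall>v \<Xi>. FLC_transversal \<Omega> \<Xi> \<longrightarrow> locally_constant_on (tiling_topology \<Omega>) \<Xi> (\<lambda>T. \<alpha> T v))"

definition flow_box :: "('a::euclidean_space, 'l) pattern set \<Rightarrow> real \<Rightarrow> ('a, 'l) pattern set" where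
  "flow_box \<Xi> \<epsilon> = {shift x S | S x. S \<in> \<Xi> \<and> norm x < \<epsilon>}"

text \<open>The coordinates \<open>S\<close>, \<open>x\<close> of the point $S - x$ of a flow box have to be unique.\<close>

definition open_flow_box ::
    "('a::euclidean_space, 'l::metric_space) pattern set \<Rightarrow> ('a, 'l) pattern set \<Rightarrow> real \<Rightarrow> bool" where
  "open_flow_box \<Omega> \<Xi> \<epsilon> \<longleftrightarrow>
     FLC_transversal \<Omega> \<Xi> \<and> 0 < \<epsilon> \<and> inj_on (\<lambda>(S, x). shift x S) (\<Xi> \<times> ball 0 \<epsilon>) \<and>
     openin (tiling_topology \<Omega>) (flow_box \<Xi> \<epsilon>)"

definition flow_box_fun ::
    "(('a::euclidean_space, 'l) pattern \<Rightarrow> 'a \<Rightarrow> 'a) \<Rightarrow> ('a, 'l) pattern set \<Rightarrow> real \<Rightarrow>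
     ('a, 'l) pattern \<Rightarrow> 'a" where
  "flow_box_fun \<alpha> \<Xi> \<epsilon> T = (THE c. \<exists>S x. S \<in> \<Xi> \<and> norm x < \<epsilon> \<and> T = shift x S \<and> c = \<alpha> S x)"

definition flow_box_cocycle ::
    "(('a::euclidean_space, 'l) pattern \<Rightarrow> 'a \<Rightarrow> 'a) \<Rightarrow>
     (('a, 'l) pattern \<Rightarrow> ('a, 'l) pattern set) \<Rightarrow> (('a, 'l) pattern \<Rightarrow> real) \<Rightarrow>
     (('a, 'l) pattern, 'a) cech_cochain" where
  "flow_box_cocycle \<alpha> \<Xi> \<epsilon> =
     ((\<lambda>T. flow_box (\<Xi> T) (\<epsilon> T)),
      (\<lambda>T T' P. flow_box_fun \<alpha> (\<Xi> T) (\<epsilon> T) P - flow_box_fun \<alpha> (\<Xi> T') (\<epsilon> T') P))"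

text \<open>The image in $\check{H}^1(\Omega;\mathbb{R}^d)$ of the class of the strong cocycle \<open>\<alpha>\<close>. All covers
  by open flow boxes give the same Cech class, hence the union below is just this class.\<close>

definition strong_to_cech ::
    "('a::euclidean_space, 'l::metric_space) pattern set \<Rightarrow> (('a, 'l) pattern \<Rightarrow> 'a \<Rightarrow> 'a) \<Rightarrow>
     (('a, 'l) pattern, 'a) cech_cochain set" where
  "strong_to_cech \<Omega> \<alpha> =
     (\<Union>(\<Xi>, \<epsilon>) \<in> {(\<Xi>, \<epsilon>). \<forall>T\<in>\<Omega>. open_flow_box \<Omega> (\<Xi> T) (\<epsilon> T) \<and> T \<in> flow_box (\<Xi> T) (\<epsilon> T)}.
        cech_rel (tiling_topology \<Omega>) `` {flow_box_cocycle \<alpha> \<Xi> \<epsilon>})"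

definition fundamental_class ::
    "('a::euclidean_space, 'l::metric_space) pattern set \<Rightarrow> (('a, 'l) pattern, 'a) cech_cochain set" where
  "fundamental_class \<Omega> = strong_to_cech \<Omega> (\<lambda>T v. v)"

definition map_class ::
    "('a::euclidean_space, 'l::metric_space) pattern set \<Rightarrow> ('a, 'm::metric_space) pattern set \<Rightarrow>
     (('a, 'l) pattern \<Rightarrow> ('a, 'm) pattern) \<Rightarrow> (('a, 'l) pattern, 'a) cech_cochain set" where
  "map_class \<Omega> \<Omega>' f = cech_pullback (tiling_topology \<Omega>) f (fundamental_class \<Omega>')"


section \<open>Basic properties\<close>

lemma tiling_close_mono:
  assumes "tiling_close \<delta> T T'" "0 < \<delta>" "\<delta> \<le> \<epsilon>"
  shows "tiling_close \<epsilon> T T'"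
proof -
  have "1 / \<epsilon> \<le> 1 / \<delta>" using assms by (simp add: frac_le)
  then have "patch S 0 (1 / \<epsilon>) \<subseteq> patch S 0 (1 / \<delta>)" for S :: "('a, 'b) pattern"
    unfolding patch_def by fastforce
  note p = this
  from assms(1) obtain A A' \<beta> where "patch T 0 (1 / \<delta>) \<subseteq> A" "A \<subseteq> T"
    "patch T' 0 (1 / \<delta>) \<subseteq> A'" "A' \<subseteq> T'" "bij_betw \<beta> A A'" "\<forall>t\<in>A. tile_dist t (\<beta> t) < \<delta>"
    unfolding tiling_close_def by blast
  with p[of T] p[of T'] assms(3) show ?thesis unfolding tiling_close_def
    by (intro exI[of _ A] exI[of _ A'] exI[of _ \<beta>]) auto
qed

lemma openin_tiling_topology:
  "openin (tiling_topology \<Omega>) U \<longleftrightarrow>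
     U \<subseteq> \<Omega> \<and> (\<forall>T\<in>U. \<exists>\<epsilon>>0. \<forall>T'\<in>\<Omega>. tiling_close \<epsilon> T T' \<longrightarrow> T' \<in> U)"
proof -
  have "istopology (\<lambda>U. U \<subseteq> \<Omega> \<and> (\<forall>T\<in>U. \<exists>\<epsilon>>0. \<forall>T'\<in>\<Omega>. tiling_close \<epsilon> T T' \<longrightarrow> T' \<in> U))"
    (is "istopology ?P")
    unfolding istopology_def
  proof (intro conjI[of "\<forall>S S'. ?P S \<longrightarrow> ?P S' \<longrightarrow> ?P (S \<inter> S')"] allI impI)
    fix S S' assume S: "?P S" "?P S'"
    show "?P (S \<inter> S')"
    proof (intro conjI ballI)
      fix T assume T: "T \<in> S \<inter> S'"
      obtain e where e: "e > 0" "\<forall>T'\<in>\<Omega>. tiling_close e T T' \<longrightarrow> T' \<in> S" using S T by blast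
      obtain e' where e': "e' > 0" "\<forall>T'\<in>\<Omega>. tiling_close e' T T' \<longrightarrow> T' \<in> S'" using S T by blast
      show "\<exists>\<epsilon>>0. \<forall>T'\<in>\<Omega>. tiling_close \<epsilon> T T' \<longrightarrow> T' \<in> S \<inter> S'"
        using e e' tiling_close_mono[of "min e e'" T]
        by (intro exI[of _ "min e e'"]) auto
    qed (use S in blast)
  next
    fix K assume K: "\<forall>S\<in>K. ?P S"
    show "?P (\<Union>K)"
    proof (intro conjI ballI)
      show "\<Union>K \<subseteq> \<Omega>" using K by (simp add: Union_least)
      fix T assume "T \<in> \<Union>K"
      then obtain S where S: "S \<in> K" "T \<in> S" by blast
      with K obtain e where e: "e > 0" "\<forall>T'\<in>\<Omega>. tiling_close e T T' \<longrightarrow> T' \<in> S" by metis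
      with S show "\<exists>\<epsilon>>0. \<forall>T'\<in>\<Omega>. tiling_close \<epsilon> T T' \<longrightarrow> T' \<in> \<Union>K"
        by (intro exI[of _ e]) auto
    qed
  qed
  then show ?thesis unfolding tiling_topology_def by simp
qed

lemma topspace_tiling_topology [simp]: "topspace (tiling_topology \<Omega>) = \<Omega>"
proof -
  have "openin (tiling_topology \<Omega>) \<Omega>"
    unfolding openin_tiling_topology using zero_less_one by blast
  then show ?thesis
    using openin_subset openin_topspace openin_tiling_topology by (metis subset_antisym)
qed

lemma locally_constant_on_iff:
  assumes "A \<subseteq> topspace X"
  shows "locally_constant_on X A f \<longleftrightarrow>
    (\<forall>x\<in>A. \<exists>N. openin X N \<and> x \<in> N \<and> (\<forall>y \<in> N \<inter> A. f y = f x))"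
proof
  assume L: "locally_constant_on X A f"
  show "\<forall>x\<in>A. \<exists>N. openin X N \<and> x \<in> N \<and> (\<forall>y \<in> N \<inter> A. f y = f x)"
  proof
    fix x assume x: "x \<in> A"
    have "openin (subtopology X A) {y \<in> topspace (subtopology X A). f y \<in> {f x}}"
      using L unfolding locally_constant_on_def by (rule openin_continuous_map_preimage) simp
    then obtain N where "openin X N" "{y \<in> topspace (subtopology X A). f y \<in> {f x}} = N \<inter> A"
      unfolding openin_subtopology by blast
    then show "\<exists>N. openin X N \<and> x \<in> N \<and> (\<forall>y \<in> N \<inter> A. f y = f x)"
      using x assms by (intro exI[of _ N]) auto
  qed
next
  assume R: "\<forall>x\<in>A. \<exists>N. openin X N \<and> x \<in> N \<and> (\<forall>y \<in> N \<inter> A. f y = f x)"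
  have "openin (subtopology X A) {y \<in> topspace (subtopology X A). f y \<in> U}" for U
  proof (subst openin_subopen, rule ballI)
    fix x assume "x \<in> {y \<in> topspace (subtopology X A). f y \<in> U}"
    then have x: "x \<in> topspace (subtopology X A)" "f x \<in> U" by auto
    then obtain N where N: "openin X N" "x \<in> N" "\<forall>y \<in> N \<inter> A. f y = f x" using R by auto
    show "\<exists>T. openin (subtopology X A) T \<and> x \<in> T \<and> T \<subseteq> {y \<in> topspace (subtopology X A). f y \<in> U}"
    proof (intro exI[of _ "N \<inter> A"] conjI)
      show "openin (subtopology X A) (N \<inter> A)" using N by (auto simp: openin_subtopology)
      show "x \<in> N \<inter> A" using x(1) N(2) by simp
      show "N \<inter> A \<subseteq> {y \<in> topspace (subtopology X A). f y \<in> U}"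
      proof
        fix y assume y: "y \<in> N \<inter> A"
        then have "f y \<in> U" using bspec[OF N(3) y] x(2) by (simp only:)
        then show "y \<in> {y \<in> topspace (subtopology X A). f y \<in> U}" using y assms by auto
      qed
    qed
  qed
  then show "locally_constant_on X A f"
    unfolding locally_constant_on_def continuous_map_def by auto
qed

lemma locally_constant_on_subset:
  "locally_constant_on X A f \<Longrightarrow> B \<subseteq> A \<Longrightarrow> locally_constant_on X B f"
  unfolding locally_constant_on_def by (rule continuous_map_from_subtopology_mono)

lemma locally_constant_on_add:
  fixes f g :: "'x \<Rightarrow> 'v::ab_group_add"
  assumes "A \<subseteq> topspace X" "locally_constant_on X A f" "locally_constant_on X A g"
  shows "locally_constant_on X A (\<lambda>p. f p + g p)"
  unfolding locally_constant_on_iff[OF assms(1)]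
proof
  fix x assume x: "x \<in> A"
  obtain M where M: "openin X M" "x \<in> M" "\<forall>y \<in> M \<inter> A. f y = f x"
    using bspec[OF assms(2)[unfolded locally_constant_on_iff[OF assms(1)]] x] by (elim exE conjE)
  obtain N where N: "openin X N" "x \<in> N" "\<forall>y \<in> N \<inter> A. g y = g x"
    using bspec[OF assms(3)[unfolded locally_constant_on_iff[OF assms(1)]] x] by (elim exE conjE)
  show "\<exists>N. openin X N \<and> x \<in> N \<and> (\<forall>y \<in> N \<inter> A. f y + g y = f x + g x)"
  proof (intro exI[of _ "M \<inter> N"] conjI ballI)
    fix y assume "y \<in> M \<inter> N \<inter> A"
    then have "f y = f x" "g y = g x" using bspec[OF M(3)] bspec[OF N(3)] by blast+
    then show "f y + g y = f x + g x" by (simp only:)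
  qed (use M N in auto)
qed

lemma locally_constant_on_minus:
  fixes f :: "'x \<Rightarrow> 'v::ab_group_add"
  assumes "A \<subseteq> topspace X" "locally_constant_on X A f"
  shows "locally_constant_on X A (\<lambda>p. - f p)"
  using assms by (simp add: locally_constant_on_iff)

lemma point_cover_subset: "point_cover X U \<Longrightarrow> x \<in> topspace X \<Longrightarrow> U x \<subseteq> topspace X"
  by (auto simp: point_cover_def dest: openin_subset)

lemma equiv_cech_rel:
  "equiv (cech_cocycles X) (cech_rel X :: (('x, 'v::ab_group_add) cech_cochain \<times> _) set)"
proof (rule equivI)
  show "cech_rel X \<subseteq> cech_cocycles X \<times> cech_cocycles X"
    by (auto simp: cech_rel_def)
  show "refl_on (cech_cocycles X) (cech_rel X :: (('x, 'v) cech_cochain \<times> _) set)"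
  proof (rule refl_onI)
    fix c :: "('x, 'v) cech_cochain" assume c: "c \<in> cech_cocycles X"
    obtain U g where cUg: "c = (U, g)" by (cases c)
    with c have U: "point_cover X U" by (simp add: cech_cocycles_def)
    have "locally_constant_on X (U x) (\<lambda>_. 0 :: 'v)" for x
      by (simp add: locally_constant_on_def)
    with c U show "(c, c) \<in> cech_rel X"
      unfolding cUg cech_rel_def
      by (auto intro!: exI[of _ U] exI[of _ "\<lambda>_ _. 0"])
  qed
  show "sym (cech_rel X :: (('x, 'v) cech_cochain \<times> _) set)"
  proof (rule symI)
    fix c d :: "('x, 'v) cech_cochain" assume cd: "(c, d) \<in> cech_rel X"
    obtain U g V h where UV: "c = (U, g)" "d = (V, h)" by (cases c, cases d)
    from cd obtain W s where W: "point_cover X W"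
      "\<forall>x\<in>topspace X. W x \<subseteq> U x \<inter> V x \<and> locally_constant_on X (W x) (s x)"
      "\<forall>x\<in>topspace X. \<forall>y\<in>topspace X. \<forall>p \<in> W x \<inter> W y. g x y p - h x y p = s x p - s y p"
      and C: "(U, g) \<in> cech_cocycles X" "(V, h) \<in> cech_cocycles X"
      unfolding UV cech_rel_def by auto
    have "\<exists>W s. point_cover X W \<and>
           (\<forall>x\<in>topspace X. W x \<subseteq> V x \<inter> U x \<and> locally_constant_on X (W x) (s x)) \<and>
           (\<forall>x\<in>topspace X. \<forall>y\<in>topspace X. \<forall>p \<in> W x \<inter> W y. h x y p - g x y p = s x p - s y p)"
    proof (intro exI[of _ W] exI[of _ "\<lambda>x p. - s x p"] conjI ballI)
      fix x assume x: "x \<in> topspace X"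
      show "locally_constant_on X (W x) (\<lambda>p. - s x p)"
        using W(2) x by (intro locally_constant_on_minus point_cover_subset[OF W(1)]) auto
      fix y p assume "y \<in> topspace X" "p \<in> W x \<inter> W y"
      with W(3) x have "g x y p - h x y p = s x p - s y p" by simp
      then have "- (g x y p - h x y p) = - (s x p - s y p)" by simp
      then show "h x y p - g x y p = - s x p - - s y p" by simp
    qed (use W in auto)
    with C show "(d, c) \<in> cech_rel X" unfolding UV cech_rel_def by auto
  qed
  show "trans (cech_rel X :: (('x, 'v) cech_cochain \<times> _) set)"
  proof (rule transI)
    fix c d e :: "('x, 'v) cech_cochain"
    assume cd: "(c, d) \<in> cech_rel X" and de: "(d, e) \<in> cech_rel X"
    obtain U g V h V' h' where UV: "c = (U, g)" "d = (V, h)" "e = (V', h')"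
      by (cases c, cases d, cases e)
    from cd obtain W s where W: "point_cover X W"
      "\<forall>x\<in>topspace X. W x \<subseteq> U x \<inter> V x \<and> locally_constant_on X (W x) (s x)"
      "\<forall>x\<in>topspace X. \<forall>y\<in>topspace X. \<forall>p \<in> W x \<inter> W y. g x y p - h x y p = s x p - s y p"
      and C: "(U, g) \<in> cech_cocycles X"
      unfolding UV cech_rel_def by auto
    from de obtain W' s' where W': "point_cover X W'"
      "\<forall>x\<in>topspace X. W' x \<subseteq> V x \<inter> V' x \<and> locally_constant_on X (W' x) (s' x)"
      "\<forall>x\<in>topspace X. \<forall>y\<in>topspace X. \<forall>p \<in> W' x \<inter> W' y. h x y p - h' x y p = s' x p - s' y p"
      and C': "(V', h') \<in> cech_cocycles X"
      unfolding UV cech_rel_def by auto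
    have "\<exists>W s. point_cover X W \<and>
           (\<forall>x\<in>topspace X. W x \<subseteq> U x \<inter> V' x \<and> locally_constant_on X (W x) (s x)) \<and>
           (\<forall>x\<in>topspace X. \<forall>y\<in>topspace X. \<forall>p \<in> W x \<inter> W y. g x y p - h' x y p = s x p - s y p)"
    proof (intro exI[of _ "\<lambda>x. W x \<inter> W' x"] exI[of _ "\<lambda>x p. s x p + s' x p"] conjI ballI)
      show "point_cover X (\<lambda>x. W x \<inter> W' x)"
        using W(1) W'(1) by (auto simp: point_cover_def)
      fix x assume x: "x \<in> topspace X"
      show "W x \<inter> W' x \<subseteq> U x \<inter> V' x" using W(2) W'(2) x by blast
      have "W x \<inter> W' x \<subseteq> topspace X" using point_cover_subset[OF W(1) x] by (simp add: le_infI1)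
      moreover have "locally_constant_on X (W x \<inter> W' x) (s x)"
        using bspec[OF W(2) x] locally_constant_on_subset[of X "W x" "s x"] by simp
      moreover have "locally_constant_on X (W x \<inter> W' x) (s' x)"
        using bspec[OF W'(2) x] locally_constant_on_subset[of X "W' x" "s' x"] by simp
      ultimately show "locally_constant_on X (W x \<inter> W' x) (\<lambda>p. s x p + s' x p)"
        by (rule locally_constant_on_add)
      fix y p assume yp: "y \<in> topspace X" "p \<in> W x \<inter> W' x \<inter> (W y \<inter> W' y)"
      have "g x y p - h' x y p = (g x y p - h x y p) + (h x y p - h' x y p)" by simp
      also have "\<dots> = (s x p - s y p) + (s' x p - s' y p)" using W(3) W'(3) x yp by simp
      finally show "g x y p - h' x y p = s x p + s' x p - (s y p + s' y p)"
        by (simp only: add_diff_add)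
    qed
    with C C' show "(c, e) \<in> cech_rel X" unfolding UV cech_rel_def by auto
  qed
qed

lemma locally_constant_on_pullback:
  assumes "continuous_map X Y f" "locally_constant_on Y A g"
    "B \<subseteq> topspace X" "\<And>p. p \<in> B \<Longrightarrow> f p \<in> A"
  shows "locally_constant_on X B (\<lambda>p. g (f p))"
proof -
  have "continuous_map (subtopology X B) (subtopology Y A) f"
    using assms by (auto simp: continuous_map_in_subtopology continuous_map_from_subtopology)
  then have "continuous_map (subtopology X B) (discrete_topology UNIV) (g \<circ> f)"
    using assms(2) unfolding locally_constant_on_def by (rule continuous_map_compose)
  then show ?thesis unfolding locally_constant_on_def by (simp add: o_def)
qed

lemma point_cover_pullback:
  assumes f: "continuous_map X Y f" and U: "point_cover Y U"
  shows "point_cover X (\<lambda>x. {p \<in> topspace X. f p \<in> U (f x)})"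
  unfolding point_cover_def
proof (intro ballI conjI)
  fix x assume x: "x \<in> topspace X"
  then have "f x \<in> topspace Y" using f by (simp add: continuous_map_def Pi_iff)
  with U have *: "openin Y (U (f x))" "f x \<in> U (f x)" by (auto simp: point_cover_def)
  show "openin X {p \<in> topspace X. f p \<in> U (f x)}"
    using f *(1) by (rule openin_continuous_map_preimage)
  show "x \<in> {p \<in> topspace X. f p \<in> U (f x)}" using x * by simp
qed

lemma cocycle_pullback_in:
  assumes f: "continuous_map X Y f" and c: "c \<in> cech_cocycles Y"
  shows "cocycle_pullback X f c \<in> cech_cocycles X"
proof -
  obtain U g where c': "c = (U, g)" by (cases c)
  have U: "point_cover Y U"
    and g: "\<And>x y. x \<in> topspace Y \<Longrightarrow> y \<in> topspace Y \<Longrightarrow> locally_constant_on Y (U x \<inter> U y) (g x y)"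
    and a: "\<And>x y z p. x \<in> topspace Y \<Longrightarrow> y \<in> topspace Y \<Longrightarrow> z \<in> topspace Y \<Longrightarrow>
      p \<in> U x \<inter> U y \<inter> U z \<Longrightarrow> g x y p + g y z p = g x z p"
    using c unfolding c' cech_cocycles_def by auto
  have fx: "f x \<in> topspace Y" if "x \<in> topspace X" for x
    using f that by (simp add: continuous_map_def Pi_iff)
  show ?thesis
    unfolding c' cocycle_pullback_def cech_cocycles_def
    using point_cover_pullback[OF f U] fx a
    by (auto intro!: locally_constant_on_pullback[OF f g])
qed

lemma cocycle_pullback_rel:
  assumes f: "continuous_map X Y f" and cd: "(c, d) \<in> cech_rel Y"
  shows "(cocycle_pullback X f c, cocycle_pullback X f d) \<in> cech_rel X"
proof -
  obtain U g V h where UV: "c = (U, g)" "d = (V, h)" by (cases c, cases d)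
  from cd obtain W s where W: "point_cover Y W"
    "\<forall>x\<in>topspace Y. W x \<subseteq> U x \<inter> V x \<and> locally_constant_on Y (W x) (s x)"
    "\<forall>x\<in>topspace Y. \<forall>y\<in>topspace Y. \<forall>p \<in> W x \<inter> W y. g x y p - h x y p = s x p - s y p"
    and C: "c \<in> cech_cocycles Y" "d \<in> cech_cocycles Y"
    unfolding UV cech_rel_def by auto
  have fx: "f x \<in> topspace Y" if "x \<in> topspace X" for x
    using f that by (simp add: continuous_map_def Pi_iff)
  let ?W = "\<lambda>x. {p \<in> topspace X. f p \<in> W (f x)}"
  have 1: "point_cover X ?W" by (rule point_cover_pullback[OF f W(1)])
  have 2: "\<forall>x\<in>topspace X. ?W x \<subseteq> {p \<in> topspace X. f p \<in> U (f x)} \<inter> {p \<in> topspace X. f p \<in> V (f x)} \<and>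
      locally_constant_on X (?W x) (\<lambda>p. s (f x) (f p))"
  proof (intro ballI conjI)
    fix x assume x: "x \<in> topspace X"
    have *: "W (f x) \<subseteq> U (f x) \<inter> V (f x)" "locally_constant_on Y (W (f x)) (s (f x))"
      using bspec[OF W(2) fx[OF x]] by auto
    show "?W x \<subseteq> {p \<in> topspace X. f p \<in> U (f x)} \<inter> {p \<in> topspace X. f p \<in> V (f x)}"
      using *(1) by auto
    show "locally_constant_on X (?W x) (\<lambda>p. s (f x) (f p))"
      by (rule locally_constant_on_pullback[OF f *(2)]) auto
  qed
  have 3: "\<forall>x\<in>topspace X. \<forall>y\<in>topspace X. \<forall>p \<in> ?W x \<inter> ?W y.
      g (f x) (f y) (f p) - h (f x) (f y) (f p) = s (f x) (f p) - s (f y) (f p)"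
    using W(3) fx by simp
  have "\<exists>W s. point_cover X W \<and>
     (\<forall>x\<in>topspace X. W x \<subseteq> {p \<in> topspace X. f p \<in> U (f x)} \<inter> {p \<in> topspace X. f p \<in> V (f x)} \<and>
        locally_constant_on X (W x) (s x)) \<and>
     (\<forall>x\<in>topspace X. \<forall>y\<in>topspace X. \<forall>p \<in> W x \<inter> W y.
        g (f x) (f y) (f p) - h (f x) (f y) (f p) = s x p - s y p)"
    by (intro exI[of _ ?W] exI[of _ "\<lambda>x p. s (f x) (f p)"] conjI 1 2 3)
  with cocycle_pullback_in[OF f C(1)] cocycle_pullback_in[OF f C(2)] show ?thesis
    unfolding UV cocycle_pullback_def cech_rel_def by simp
qed

lemma cech_pullback_class:
  assumes f: "continuous_map X Y f" and c: "c \<in> cech_cocycles Y"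
  shows "cech_pullback X f (cech_rel Y `` {c}) = cech_rel X `` {cocycle_pullback X f c}"
proof -
  have "cech_rel X `` {cocycle_pullback X f d} = cech_rel X `` {cocycle_pullback X f c}"
    if "d \<in> cech_rel Y `` {c}" for d
    using equiv_class_eq[OF equiv_cech_rel cocycle_pullback_rel[OF f]] that by (metis Image_singleton_iff)
  moreover have "c \<in> cech_rel Y `` {c}"
    using equiv_class_self[OF equiv_cech_rel c] .
  ultimately show ?thesis unfolding cech_pullback_def by blast
qed

lemma cech_pullback_H1:
  assumes f: "continuous_map X Y f" and \<kappa>: "\<kappa> \<in> cech_H1 Y"
  shows "cech_pullback X f \<kappa> \<in> cech_H1 X"
proof -
  obtain c where c: "c \<in> cech_cocycles Y" "\<kappa> = cech_rel Y `` {c}"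
    using \<kappa> unfolding cech_H1_def by (rule quotientE)
  show ?thesis
    unfolding c(2) cech_pullback_class[OF f c(1)] cech_H1_def
    by (rule quotientI[OF cocycle_pullback_in[OF f c(1)]])
qed

lemma strong_cocycle_fundamental: "strong_cocycle \<Omega> (\<lambda>T v. v)"
  unfolding strong_cocycle_def locally_constant_on_def
  by (simp add: case_prod_unfold continuous_map_snd)

end

theory Submission
  imports Defs
begin

text \<open>
  Coordinates on flow boxes turn the equality of the two Cech classes into a displacement. On a flow
  box \<open>{S - x}\<close> the coordinate \<open>c\<close> of \<open>S - x\<close> is \<open>x\<close>. It depends only on a large patch around the
  origin, and it records small translations exactly: if \<open>T' - x\<close> agrees with \<open>T\<close> on a large ball and
  \<open>x\<close> is small, then \<open>c(T') = c(T) - x\<close> (\<open>box_coord_chart\<close>).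

  For a point \<open>p\<close> of \<open>\<Omega>\<close> let \<open>c\<^sub>p\<close> and \<open>d\<^sub>p\<close> be the coordinates on flow boxes around \<open>h1 p\<close> and
  \<open>h2 p\<close>. That \<open>h1\<close> and \<open>h2\<close> have the same class means that there are locally constant functions
  \<open>\<sigma>\<^sub>p\<close> on neighbourhoods of the points \<open>p\<close> with
  \<open>(c\<^sub>p - c\<^sub>q) \<circ> h1 - (d\<^sub>p - d\<^sub>q) \<circ> h2 = \<sigma>\<^sub>p - \<sigma>\<^sub>q\<close>. Hence the functions
  \<open>c\<^sub>p \<circ> h1 - d\<^sub>p \<circ> h2 - \<sigma>\<^sub>p\<close> agree on overlaps and define one continuous \<open>s\<close> on \<open>\<Omega>\<close>
  (\<open>displacement_exists\<close>). The map \<open>\<psi> p = h2 p - s p\<close> is homotopic to \<open>h2\<close> through \<open>h2 p - t s p\<close>.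
  The displacement is chosen such that, up to locally constant terms, the coordinate of \<open>\<psi> p\<close> is the
  coordinate of \<open>h1 p\<close>. For \<open>\<phi> = \<psi> \<circ> h1\<inverse>\<close> this gives (\<open>displaced_map\<close>):

  \<^item> for every \<open>T\<close> and \<open>r\<close> there are \<open>R\<close> and \<open>\<delta>\<close> such that, if \<open>|x| < \<delta>\<close> and \<open>T' - x\<close> agrees with
    \<open>T\<close> on the ball of radius \<open>R\<close>, then \<open>\<phi> T' - x\<close> agrees with \<open>\<phi> T\<close> on the ball of radius \<open>r\<close>.

  For a continuous map between FLC spaces the conclusion holds in general only with a possibly
  different small translation \<open>y\<close> in place of \<open>x\<close>; the coordinates force \<open>y = x\<close>. Everything
  else follows from this property (locale \<open>displaced_local_map\<close>). It contains continuity. Along an orbit it says that each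
  patch of \<open>\<phi>(T - tv) + tv\<close> is a locally constant function of \<open>t\<close>, so \<open>\<phi>\<close> commutes with
  translations. The case \<open>x = 0\<close> is locality, where compactness makes \<open>R\<close> independent of \<open>T\<close>. The
  image of \<open>\<phi>\<close> is then closed and invariant, so \<open>\<phi>\<close> is onto by minimality.

  Two facts on FLC spaces support the argument. Their topology has as a basis the sets \<open>nearby\<close> of
  tilings that agree with a given one on a ball after a small translation
  (\<open>patches_agree_if_tiling_close\<close>); this rests on the local finiteness of tilings with a compact set
  of prototiles. And minimal FLC spaces are covered by open flow boxes (\<open>exists_open_flow_box\<close>), so that
  \<open>map_class\<close> is indeed a non-empty class of cocycles.
\<close>

section \<open>Translations and patches\<close>

lemma shift_tile_0 [simp]: "shift_tile 0 t = t"
  by (simp add: shift_tile_def)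

lemma shift_tile_shift_tile [simp]: "shift_tile x (shift_tile y t) = shift_tile (x + y) t"
  by (auto simp: shift_tile_def image_image algebra_simps)

lemma shift_0 [simp]: "shift 0 T = T"
  by (simp add: shift_def)

lemma shift_shift [simp]: "shift x (shift y T) = shift (x + y) T"
  by (simp add: shift_def image_image)

lemma mem_shift_iff: "t \<in> shift x T \<longleftrightarrow> shift_tile (- x) t \<in> T"
proof
  assume "shift_tile (- x) t \<in> T"
  then have "shift_tile x (shift_tile (- x) t) \<in> shift x T"
    unfolding shift_def by (rule imageI)
  then show "t \<in> shift x T" by simp
qed (auto simp: shift_def)

lemma fst_shift_tile: "fst (shift_tile x t) = (\<lambda>p. p - x) ` fst t"
  and snd_shift_tile [simp]: "snd (shift_tile x t) = snd t"
  by (simp_all add: shift_tile_def)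

lemma shift_tile_meets_ball_iff:
  fixes t :: "('a::real_normed_vector, 'l) tile"
  shows "fst (shift_tile x t) \<inter> ball y R \<noteq> {} \<longleftrightarrow> fst t \<inter> ball (y + x) R \<noteq> {}"
proof -
  have "p - x \<in> ball y R \<longleftrightarrow> p \<in> ball (y + x) R" for p
    by (simp add: dist_norm algebra_simps)
  then show ?thesis unfolding fst_shift_tile by (auto simp del: mem_ball)
qed

lemma patch_shift:
  fixes T :: "('a::real_normed_vector, 'l) pattern"
  shows "patch (shift x T) y R = shift x (patch T (y + x) R)"
proof (rule set_eqI)
  fix t :: "('a, 'l) tile"
  have "fst t \<inter> ball y R \<noteq> {} \<longleftrightarrow> fst (shift_tile (- x) t) \<inter> ball (y + x) R \<noteq> {}"
    by (subst shift_tile_meets_ball_iff) simp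
  then show "t \<in> patch (shift x T) y R \<longleftrightarrow> t \<in> shift x (patch T (y + x) R)"
    by (auto simp: patch_def mem_shift_iff)
qed

lemma patch_subset: "patch T x R \<subseteq> T"
  by (auto simp: patch_def)

lemma patch_mono: "ball x r \<subseteq> ball y R \<Longrightarrow> patch T x r \<subseteq> patch T y R"
  by (auto simp: patch_def)

lemma patch_patch: "ball x r \<subseteq> ball y R \<Longrightarrow> patch (patch T y R) x r = patch T x r"
  by (auto simp: patch_def)

lemma patch_eq_subball:
  assumes "patch T y R = patch T' y R" "ball x r \<subseteq> ball y R"
  shows "patch T x r = patch T' x r"
  using assms by (metis patch_patch)

lemma agree_mono:
  fixes T :: "('a::real_normed_vector, 'l) pattern"
  assumes "patch T 0 R = patch T' 0 R" "r \<le> R"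
  shows "patch T 0 r = patch T' 0 r"
  by (rule patch_eq_subball[OF assms(1) subset_ball[OF assms(2)]])

lemma patch_shift_cong:
  fixes T :: "('a::euclidean_space, 'l) pattern"
  assumes "patch T 0 R = patch T' 0 R" "norm v + r \<le> R"
  shows "patch (shift v T) 0 r = patch (shift v T') 0 r"
proof -
  have "ball (0 + v) r \<subseteq> ball 0 R" using assms(2) by (simp add: ball_subset_ball_iff)
  from patch_eq_subball[OF assms(1) this] show ?thesis by (simp add: patch_shift)
qed

lemma pattern_eqI:
  assumes "\<And>t. t \<in> T \<union> T' \<Longrightarrow> fst t \<noteq> {}" "\<And>R. 0 < R \<Longrightarrow> patch T (0::'a::real_normed_vector) R = patch T' 0 R"
  shows "T = T'"
proof -
  have "t \<in> T \<longleftrightarrow> t \<in> T'" if "t \<in> T \<union> T'" for t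
  proof -
    from assms(1)[OF that] obtain z where z: "z \<in> fst t" by blast
    then have "fst t \<inter> ball 0 (norm z + 1) \<noteq> {}" by auto
    then have "t \<in> T \<longleftrightarrow> t \<in> patch T 0 (norm z + 1)" "t \<in> T' \<longleftrightarrow> t \<in> patch T' 0 (norm z + 1)"
      by (auto simp: patch_def)
    moreover have "0 < norm z + 1" by (smt (verit) norm_ge_zero)
    ultimately show ?thesis using assms(2) by metis
  qed
  then show ?thesis by blast
qed

section \<open>The Hausdorff distance of compact sets\<close>

lemma bounded_infdist_image:
  assumes "compact A" "B \<noteq> {}"
  shows "bdd_above ((\<lambda>a. infdist a B) ` A)"
  using assms by (intro bounded_imp_bdd_above compact_imp_bounded compact_continuous_image continuous_intros)

lemma SUP_infdist_less_iff:
  fixes A B :: "'a::metric_space set"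
  assumes "compact A" "A \<noteq> {}" "compact B" "B \<noteq> {}"
  shows "(SUP a\<in>A. infdist a B) < e \<longleftrightarrow> (\<forall>a\<in>A. \<exists>b\<in>B. dist a b < e)"
proof -
  have att: "\<exists>b\<in>B. dist a b \<le> infdist a B" for a
  proof -
    obtain b where "b \<in> B" "\<And>c. c \<in> B \<Longrightarrow> dist a b \<le> dist a c"
      using continuous_attains_inf[OF assms(3,4), of "dist a"] continuous_on_dist[OF continuous_on_const continuous_on_id]
      by blast
    then show ?thesis using assms(4) by (auto simp: infdist_notempty intro!: bexI[of _ b] cINF_greatest)
  qed
  show ?thesis
  proof
    assume L: "(SUP a\<in>A. infdist a B) < e"
    have "infdist a B < e" if "a \<in> A" for a
      using cSUP_upper[OF that bounded_infdist_image[OF assms(1,4)]] L by simp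
    then show "\<forall>a\<in>A. \<exists>b\<in>B. dist a b < e" using att by (meson le_less_trans)
  next
    assume R: "\<forall>a\<in>A. \<exists>b\<in>B. dist a b < e"
    obtain a where a: "a \<in> A" "\<And>x. x \<in> A \<Longrightarrow> infdist x B \<le> infdist a B"
      using continuous_attains_sup[OF assms(1,2), of "\<lambda>a. infdist a B"]
      continuous_on_infdist[OF continuous_on_id] by blast
    then have "(SUP a\<in>A. infdist a B) \<le> infdist a B" by (intro cSUP_least assms) auto
    also obtain b where "b \<in> B" "dist a b < e" using R a by blast
    then have "infdist a B < e" using infdist_le[of b B a] by simp
    finally show "(SUP a\<in>A. infdist a B) < e" .
  qed
qed

lemma hausdorff_dist_less_iff:
  assumes "compact A" "A \<noteq> {}" "compact B" "B \<noteq> {}"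
  shows "hausdorff_dist A B < e \<longleftrightarrow>
    (\<forall>a\<in>A. \<exists>b\<in>B. dist a b < e) \<and> (\<forall>b\<in>B. \<exists>a\<in>A. dist a b < e)"
  unfolding hausdorff_dist_def max_less_iff_conj
  using SUP_infdist_less_iff[OF assms] SUP_infdist_less_iff[OF assms(3,4,1,2)]
  by (simp add: dist_commute)

lemma hausdorff_dist_commute: "hausdorff_dist A B = hausdorff_dist B A"
  by (simp add: hausdorff_dist_def max.commute)

lemma hausdorff_dist_nonneg:
  assumes "compact A" "A \<noteq> {}" "compact B" "B \<noteq> {}"
  shows "0 \<le> hausdorff_dist A B"
  using hausdorff_dist_less_iff[OF assms, of 0] assms
  by (metis all_not_in_conv not_less zero_le_dist)

lemma hausdorff_dist_triangle:
  assumes "compact A" "A \<noteq> {}" "compact B" "B \<noteq> {}" "compact C" "C \<noteq> {}"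
  shows "hausdorff_dist A C \<le> hausdorff_dist A B + hausdorff_dist B C"
proof (rule field_le_epsilon)
  fix e :: real assume e: "0 < e"
  let ?x = "hausdorff_dist A B + e/2" and ?y = "hausdorff_dist B C + e/2"
  have 1: "(\<forall>a\<in>A. \<exists>b\<in>B. dist a b < ?x) \<and> (\<forall>b\<in>B. \<exists>a\<in>A. dist a b < ?x)"
    using hausdorff_dist_less_iff[OF assms(1-4), of ?x] e by simp
  have 2: "(\<forall>a\<in>B. \<exists>b\<in>C. dist a b < ?y) \<and> (\<forall>b\<in>C. \<exists>a\<in>B. dist a b < ?y)"
    using hausdorff_dist_less_iff[OF assms(3-6), of ?y] e by simp
  have "\<forall>a\<in>A. \<exists>c\<in>C. dist a c < ?x + ?y"
    using 1 2 dist_triangle_less_add by (metis dist_commute)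
  moreover have "\<forall>c\<in>C. \<exists>a\<in>A. dist a c < ?x + ?y"
    using 1 2 dist_triangle_less_add by (metis dist_commute)
  ultimately have "hausdorff_dist A C < ?x + ?y"
    using hausdorff_dist_less_iff[OF assms(1,2,5,6)] by blast
  then show "hausdorff_dist A C \<le> hausdorff_dist A B + hausdorff_dist B C + e" by simp
qed

lemma hausdorff_dist_eq_0_iff:
  fixes A B :: "'a::metric_space set"
  assumes "compact A" "A \<noteq> {}" "compact B" "B \<noteq> {}"
  shows "hausdorff_dist A B = 0 \<longleftrightarrow> A = B"
proof
  assume 0: "hausdorff_dist A B = 0"
  have e: "(\<forall>a\<in>A. \<exists>b\<in>B. dist a b < e) \<and> (\<forall>b\<in>B. \<exists>a\<in>A. dist a b < e)" if "0 < e" for e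
    using hausdorff_dist_less_iff[OF assms, of e] 0 that by simp
  have "a \<in> closure B" if "a \<in> A" for a
    unfolding closure_approachable using e that by (metis dist_commute)
  moreover have "b \<in> closure A" if "b \<in> B" for b
    unfolding closure_approachable using e that by metis
  ultimately show "A = B" using assms by (simp add: compact_imp_closed subset_antisym subset_iff)
next
  assume "A = B"
  then have "hausdorff_dist A B \<le> e" if "0 < e" for e
    using hausdorff_dist_less_iff[OF assms, of e] that by (metis dist_self less_imp_le)
  then show "hausdorff_dist A B = 0"
    using hausdorff_dist_nonneg[OF assms] by (meson dense_ge order_antisym)
qed

lemma hausdorff_dist_translate_less:
  fixes A :: "'a::euclidean_space set"
  assumes "compact A" "A \<noteq> {}" "norm x < e"
  shows "hausdorff_dist A ((\<lambda>p. p - x) ` A) < e"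
proof -
  have "compact ((\<lambda>p. p - x) ` A)" "(\<lambda>p. p - x) ` A \<noteq> {}"
    using assms compact_translation_subtract by auto
  moreover have "dist a (a - x) < e" for a using assms(3) by (simp add: dist_norm)
  ultimately show ?thesis using hausdorff_dist_less_iff[OF assms(1,2)] by blast
qed

section \<open>Distances between tiles\<close>

definition compact_tile :: "('a::metric_space, 'l) tile \<Rightarrow> bool" where
  "compact_tile t \<longleftrightarrow> compact (fst t) \<and> fst t \<noteq> {}"

lemma compact_tile_shift_tile [simp]:
  fixes t :: "('a::euclidean_space, 'l) tile"
  shows "compact_tile (shift_tile x t) \<longleftrightarrow> compact_tile t"
proof -
  have "compact_tile t \<Longrightarrow> compact_tile (shift_tile x t)" for x and t :: "('a, 'l) tile"
    by (simp add: compact_tile_def fst_shift_tile compact_translation_subtract)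
  from this[of t x] this[of "shift_tile x t" "-x"] show ?thesis by auto
qed

lemma Metric_space_tile_dist:
  assumes "\<And>k. k \<in> K \<Longrightarrow> compact_tile k"
  shows "Metric_space K tile_dist"
proof
  fix t u v :: "('a, 'b) tile"
  show "0 \<le> tile_dist t u" by (simp add: tile_dist_def le_max_iff_disj)
  show "tile_dist t u = tile_dist u t"
    by (simp add: tile_dist_def hausdorff_dist_commute dist_commute)
  assume t: "t \<in> K" and u: "u \<in> K"
  have c: "compact (fst t)" "fst t \<noteq> {}" "compact (fst u)" "fst u \<noteq> {}"
    using assms t u by (auto simp: compact_tile_def)
  show "tile_dist t u = 0 \<longleftrightarrow> t = u"
    using hausdorff_dist_nonneg[OF c] hausdorff_dist_eq_0_iff[OF c]
    by (auto simp: tile_dist_def prod_eq_iff max_def split: if_splits)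
  assume v: "v \<in> K"
  then have c': "compact (fst v)" "fst v \<noteq> {}" using assms by (auto simp: compact_tile_def)
  show "tile_dist t v \<le> tile_dist t u + tile_dist u v"
    using hausdorff_dist_triangle[OF c c'] dist_triangle[of "snd t" "snd v" "snd u"]
    unfolding tile_dist_def by linarith
qed

lemma tile_dist_lessD:
  assumes "tile_dist t u < e" "compact_tile t" "compact_tile u"
  shows "a \<in> fst t \<Longrightarrow> \<exists>b\<in>fst u. dist a b < e" "b \<in> fst u \<Longrightarrow> \<exists>a\<in>fst t. dist a b < e"
  using assms hausdorff_dist_less_iff[of "fst t" "fst u" e]
  by (auto simp: tile_dist_def compact_tile_def)

lemma tile_dist_shift_tile_less:
  fixes t :: "('a::euclidean_space, 'l::metric_space) tile"
  assumes "compact_tile t" "norm x < e"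
  shows "tile_dist t (shift_tile x t) < e"
  using hausdorff_dist_translate_less[of "fst t" x e] assms le_less_trans[OF norm_ge_zero assms(2)]
  by (auto simp: tile_dist_def compact_tile_def fst_shift_tile)

text \<open>The upper corner of the bounding box of a tile. It is a marker that moves along with the tile
  and depends continuously on it, so it measures by how much two nearby tiles are translated
  against each other.\<close>

definition corner :: "('a::euclidean_space, 'l) tile \<Rightarrow> 'a" where
  "corner t = (\<Sum>b\<in>Basis. (SUP p\<in>fst t. p \<bullet> b) *\<^sub>R b)"

lemma bdd_above_inner_image:
  "compact_tile (t :: ('a::euclidean_space, 'l) tile) \<Longrightarrow> bdd_above ((\<lambda>p. p \<bullet> b) ` fst t)"
  unfolding compact_tile_def
  by (intro bounded_imp_bdd_above compact_imp_bounded compact_continuous_image continuous_intros) auto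

lemma corner_shift_tile:
  fixes t :: "('a::euclidean_space, 'l) tile"
  assumes "compact_tile t"
  shows "corner (shift_tile x t) = corner t - x"
proof -
  have "(SUP p\<in>fst (shift_tile x t). p \<bullet> b) = (SUP p\<in>fst t. p \<bullet> b) - x \<bullet> b" for b :: 'a
  proof -
    have "(SUP p\<in>fst (shift_tile x t). p \<bullet> b) = (SUP p\<in>fst t. - (x \<bullet> b) + p \<bullet> b)"
      by (simp add: fst_shift_tile image_image inner_diff_left)
    also have "\<dots> = - (x \<bullet> b) + (SUP p\<in>fst t. p \<bullet> b)"
      using assms by (intro Sup_add_eq bdd_above_inner_image) (auto simp: compact_tile_def)
    finally show ?thesis by simp
  qed
  then show ?thesis
    by (simp add: corner_def scaleR_diff_left sum_subtractf euclidean_representation)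
qed

lemma norm_corner_diff_le:
  fixes t :: "('a::euclidean_space, 'l::metric_space) tile"
  assumes "tile_dist t u < e" "compact_tile t" "compact_tile u"
  shows "norm (corner t - corner u) \<le> real DIM('a) * e"
proof -
  have le: "(SUP p\<in>fst t. p \<bullet> b) \<le> (SUP p\<in>fst u. p \<bullet> b) + e"
    if "b \<in> Basis" "compact_tile t" "compact_tile u" "\<forall>p\<in>fst t. \<exists>q\<in>fst u. dist p q < e"
    for b and t u :: "('a, 'l) tile"
  proof (rule cSUP_least)
    fix p assume "p \<in> fst t"
    with that(4) obtain q where q: "q \<in> fst u" "dist p q < e" by blast
    have "p \<bullet> b = q \<bullet> b + (p - q) \<bullet> b" by (simp add: inner_diff_left)
    also have "q \<bullet> b \<le> (SUP p\<in>fst u. p \<bullet> b)"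
      by (rule cSUP_upper[OF q(1) bdd_above_inner_image[OF that(3)]])
    also have "(p - q) \<bullet> b \<le> e"
      using Basis_le_norm[OF that(1), of "p - q"] q(2) by (simp add: dist_norm)
    finally show "p \<bullet> b \<le> (SUP p\<in>fst u. p \<bullet> b) + e" by simp
  qed (use that in \<open>auto simp: compact_tile_def\<close>)
  have "\<bar>(corner t - corner u) \<bullet> b\<bar> \<le> e" if b: "b \<in> Basis" for b
  proof -
    have "corner v \<bullet> b = (SUP p\<in>fst v. p \<bullet> b)" for v :: "('a, 'l) tile"
      using b by (simp add: corner_def)
    moreover have "(SUP p\<in>fst t. p \<bullet> b) \<le> (SUP p\<in>fst u. p \<bullet> b) + e"
      using tile_dist_lessD[OF assms] by (intro le b assms) auto
    moreover have "(SUP p\<in>fst u. p \<bullet> b) \<le> (SUP p\<in>fst t. p \<bullet> b) + e"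
      using tile_dist_lessD[OF assms] by (intro le b assms) (metis dist_commute)
    ultimately show ?thesis by (simp add: inner_diff_left)
  qed
  then have "(\<Sum>b\<in>Basis. \<bar>(corner t - corner u) \<bullet> b\<bar>) \<le> real DIM('a) * e"
    by (rule sum_bounded_above)
  then show ?thesis using norm_le_l1[of "corner t - corner u"] by linarith
qed

section \<open>Local finiteness\<close>

text \<open>A convex set that is \<open>\<eta>\<close>-close to a set containing a ball contains the concentric ball
  that is smaller by \<open>\<eta>\<close>: a missing point could be pushed away from the convex set by \<open>\<eta>\<close>, along the
  normal of a separating hyperplane, without leaving the large ball.\<close>

lemma hausdorff_ball_subset:
  fixes k k' :: "'a::euclidean_space set"
  assumes "compact k'" "k' \<noteq> {}" "convex k'" "cball z \<rho> \<subseteq> k"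
    and near: "\<And>p. p \<in> k \<Longrightarrow> \<exists>q\<in>k'. dist p q < \<eta>" and "0 < \<eta>"
  shows "ball z (\<rho> - \<eta>) \<subseteq> k'"
proof
  fix w assume w: "w \<in> ball z (\<rho> - \<eta>)"
  show "w \<in> k'"
  proof (rule ccontr)
    assume "w \<notin> k'"
    then obtain a b where ab: "a \<bullet> w < b" "\<And>y. y \<in> k' \<Longrightarrow> a \<bullet> y > b"
      using separating_hyperplane_closed_point[of k' w] assms(1,3) compact_imp_closed by metis
    then have a0: "a \<noteq> 0" using assms(2) by fastforce
    define p where "p = w - (\<eta> / norm a) *\<^sub>R a"
    have "dist z p \<le> dist z w + norm ((\<eta> / norm a) *\<^sub>R a)"
      using dist_triangle[of z p w] by (simp add: p_def dist_norm)
    also have "norm ((\<eta> / norm a) *\<^sub>R a) = \<eta>" using a0 \<open>0 < \<eta>\<close> by simp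
    finally have "p \<in> k" using w assms(4) by auto
    then obtain q where q: "q \<in> k'" "dist p q < \<eta>" using near by blast
    have "a \<bullet> q = a \<bullet> p + a \<bullet> (q - p)" by (simp add: inner_diff_right)
    also have "a \<bullet> (q - p) \<le> norm a * norm (q - p)" by (rule norm_cauchy_schwarz)
    also have "\<dots> \<le> norm a * \<eta>" using q(2) by (intro mult_left_mono) (auto simp: dist_norm norm_minus_commute)
    also have "a \<bullet> p = a \<bullet> w - norm a * \<eta>"
      using a0 by (simp add: p_def inner_diff_right dot_square_norm power2_eq_square)
    finally show False using ab(1) ab(2)[OF q(1)] by simp
  qed
qed

text \<open>Containing a ball and having bounded diameter are stable under small Hausdorff perturbations of
  convex sets, so both hold uniformly on a compact set of prototiles.\<close>

lemma prototiles_uniform_size: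
  fixes K :: "('a::euclidean_space, 'l::metric_space) tile set"
  assumes K: "Ball K is_tile" "compact_space (Metric_space.mtopology K tile_dist)"
  obtains \<rho> D where "0 < \<rho>" "\<And>k. k \<in> K \<Longrightarrow> \<exists>z. ball z \<rho> \<subseteq> fst k"
    "\<And>k p q. k \<in> K \<Longrightarrow> p \<in> fst k \<Longrightarrow> q \<in> fst k \<Longrightarrow> dist p q \<le> D"
proof -
  have ct: "compact_tile k" if "k \<in> K" for k
    using K(1) that interior_subset unfolding is_tile_def compact_tile_def
    by (auto intro: polytope_imp_compact)
  interpret Metric_space K tile_dist by (rule Metric_space_tile_dist[OF ct])
  \<comment> \<open>The factor \<open>2\<close> leaves a ball of radius \<open>r\<close> after a perturbation by less than \<open>r\<close>.\<close>
  have "\<exists>r>0. \<exists>z. cball z (2 * r) \<subseteq> fst k" if "k \<in> K" for k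
  proof -
    obtain z where "z \<in> interior (fst k)" using K(1) \<open>k \<in> K\<close> by (auto simp: is_tile_def)
    then obtain r where "r > 0" "cball z r \<subseteq> fst k" using mem_interior_cball by blast
    then show ?thesis by (intro exI[of _ "r/2"]) auto
  qed
  then obtain r z where r: "\<And>k. k \<in> K \<Longrightarrow> 0 < r k" "\<And>k. k \<in> K \<Longrightarrow> cball (z k) (2 * r k) \<subseteq> fst k"
    by metis
  have "K \<subseteq> \<Union>((\<lambda>k. mball k (r k)) ` K)" using r(1) by auto
  moreover have "\<forall>U\<in>(\<lambda>k. mball k (r k)) ` K. openin mtopology U" by auto
  ultimately obtain F where F: "finite F" "F \<subseteq> (\<lambda>k. mball k (r k)) ` K" "K \<subseteq> \<Union>F"
    using K(2) unfolding compact_space_alt topspace_mtopology by meson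
  obtain C where C: "finite C" "C \<subseteq> K" "K \<subseteq> (\<Union>k\<in>C. mball k (r k))"
    using finite_subset_image[OF F(1,2)] F(3) by blast
  define \<rho> where "\<rho> = Min (insert 1 (r ` C))"
  define D where "D = Max (insert 0 ((\<lambda>k. diameter (fst k) + 2 * r k) ` C))"
  show thesis
  proof
    show "0 < \<rho>" unfolding \<rho>_def using C r by (auto simp: subset_iff)
    fix k assume k: "k \<in> K"
    then obtain c where c: "c \<in> C" "k \<in> mball c (r c)" using C(3) by blast
    then have cK: "c \<in> K" and d: "tile_dist c k < r c" by auto
    note near = tile_dist_lessD[OF d ct[OF cK] ct[OF k]]
    have "\<rho> \<le> r c" unfolding \<rho>_def using C(1) c(1) by auto
    have "ball (z c) (2 * r c - r c) \<subseteq> fst k"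
      using K(1) k r cK ct[OF k]
      by (intro hausdorff_ball_subset[OF _ _ _ r(2)[OF cK] near(1)])
        (auto simp: is_tile_def compact_tile_def polytope_imp_convex)
    then have "ball (z c) \<rho> \<subseteq> fst k" using \<open>\<rho> \<le> r c\<close> by auto
    then show "\<exists>z. ball z \<rho> \<subseteq> fst k" by blast
    fix p q assume "p \<in> fst k" "q \<in> fst k"
    then obtain p' q' where pq: "p' \<in> fst c" "dist p' p < r c" "q' \<in> fst c" "dist q' q < r c"
      using near(2) by blast
    have "bounded (fst c)" using ct[OF cK] by (simp add: compact_tile_def compact_imp_bounded)
    then have "dist p' q' \<le> diameter (fst c)" using pq by (intro diameter_bounded_bound)
    moreover have "dist p q \<le> dist p' p + (dist p' q' + dist q' q)"
      using dist_triangle[of p q p'] dist_triangle[of p' q q'] by (simp add: dist_commute)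
    moreover have "diameter (fst c) + 2 * r c \<le> D" unfolding D_def using C(1) c(1) by auto
    ultimately show "dist p q \<le> D" using pq by linarith
  qed
qed

lemma finite_separated_bounded:
  fixes S :: "'a::euclidean_space set"
  assumes "bounded S" "0 < \<rho>" "\<And>x y. x \<in> S \<Longrightarrow> y \<in> S \<Longrightarrow> x \<noteq> y \<Longrightarrow> \<rho> \<le> dist x y"
  shows "finite S"
proof (rule ccontr)
  assume "infinite S"
  then obtain l where "l islimpt S" using assms(1) bounded_infinite_imp_islimpt by blast
  then have inf: "infinite (S \<inter> ball l (\<rho>/2))" using assms(2) by (simp add: islimpt_eq_infinite_ball)
  then obtain x where x: "x \<in> S \<inter> ball l (\<rho>/2)" by (metis finite.emptyI all_not_in_conv)
  have "infinite (S \<inter> ball l (\<rho>/2) - {x})" using inf by simp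
  then obtain y where y: "y \<in> S \<inter> ball l (\<rho>/2) - {x}" by (metis finite.emptyI all_not_in_conv)
  have "dist x y \<le> dist x l + dist l y" by (rule dist_triangle)
  then show False using assms(3)[of x y] x y by (auto simp: dist_commute)
qed

lemma finite_patch_delone:
  assumes "is_delone T"
  shows "finite (patch T x R)"
proof -
  obtain r where r: "0 < r" "\<And>p l q m. ({p}, l) \<in> T \<Longrightarrow> ({q}, m) \<in> T \<Longrightarrow> (p, l) \<noteq> (q, m) \<Longrightarrow> r \<le> dist p q"
    using assms unfolding is_delone_def by metis
  have pt: "\<exists>p. t = ({p}, snd t)" if "t \<in> T" for t
    using assms that by (auto simp: is_delone_def is_point_def prod_eq_iff)
  define S where "S = {p \<in> ball x R. \<exists>l. ({p}, l) \<in> T}"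
  have "finite S"
  proof (rule finite_separated_bounded[OF _ r(1)])
    show "bounded S" unfolding S_def by (rule bounded_subset[OF bounded_ball[of x R]]) auto
  qed (auto simp: S_def intro: r(2))
  have "patch T x R \<subseteq> (\<lambda>p. ({p}, THE l. ({p}, l) \<in> T)) ` S"
  proof
    fix t assume t: "t \<in> patch T x R"
    then have tT: "t \<in> T" using patch_subset by blast
    from pt[OF this] obtain p where p: "t = ({p}, snd t)" by blast
    from tT have pT: "({p}, snd t) \<in> T" by (subst (asm) p)
    have "(THE l. ({p}, l) \<in> T) = snd t"
    proof (rule the_equality)
      show "({p}, snd t) \<in> T" by (rule pT)
      fix l assume "({p}, l) \<in> T"
      from r(2)[OF this pT] show "l = snd t" using r(1) by auto
    qed
    moreover have "p \<in> S"
    proof -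
      have ft: "fst t = {p}" using arg_cong[OF p, of fst] by simp
      have "fst t \<inter> ball x R \<noteq> {}" using t by (simp add: patch_def)
      then have "p \<in> ball x R" unfolding ft by auto
      then show ?thesis using pT unfolding S_def by blast
    qed
    ultimately show "t \<in> (\<lambda>p. ({p}, THE l. ({p}, l) \<in> T)) ` S"
      by (intro image_eqI[of _ _ p]) (simp_all flip: p)
  qed
  then show ?thesis using \<open>finite S\<close> finite_surj by blast
qed

text \<open>Tiles with disjoint interiors that contain balls of radius \<open>\<rho>\<close> have \<open>\<rho>\<close>-separated centres, and
  bounded diameters keep the centres of the tiles of a patch in a bounded region.\<close>

lemma finite_patch_tiling:
  fixes T :: "('a::euclidean_space, 'l) pattern"
  assumes T: "is_tiling T" and \<rho>: "0 < \<rho>"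
    and "\<And>t. t \<in> T \<Longrightarrow> \<exists>z. ball z \<rho> \<subseteq> fst t"
    and D: "\<And>t p q. t \<in> T \<Longrightarrow> p \<in> fst t \<Longrightarrow> q \<in> fst t \<Longrightarrow> dist p q \<le> D"
  shows "finite (patch T x R)"
proof -
  obtain c where c: "\<And>t. t \<in> T \<Longrightarrow> ball (c t) \<rho> \<subseteq> fst t" using assms(3) by metis
  have sep: "\<rho> \<le> dist (c t) (c u)" if "t \<in> T" "u \<in> T" "t \<noteq> u" for t u
  proof (rule ccontr)
    assume "\<not> \<rho> \<le> dist (c t) (c u)"
    then have "c t \<in> fst t \<inter> fst u" using c[OF that(1)] c[OF that(2)] \<rho>
      by (auto simp: dist_commute subset_iff)
    moreover have "c t \<in> interior (fst t)"
      using c[OF that(1)] \<rho> by (auto simp: mem_interior)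
    ultimately show False using T that unfolding is_tiling_def frontier_def by blast
  qed
  have in_D: "dist x (c t) \<le> R + D" if t: "t \<in> patch T x R" for t
  proof -
    from t obtain p where p: "p \<in> fst t" "dist x p < R" and tT: "t \<in> T" by (auto simp: patch_def)
    have "c t \<in> fst t" using c[OF tT] \<rho> by auto
    from D[OF tT p(1) this] show ?thesis using dist_triangle[of x "c t" p] p(2) by linarith
  qed
  have "finite (c ` patch T x R)"
  proof (rule finite_separated_bounded[OF _ \<rho>])
    show "bounded (c ` patch T x R)"
      using in_D by (intro bounded_subset[OF bounded_cball[of x "R + D"]]) auto
  qed (use sep patch_subset in blast)
  moreover have "inj_on c (patch T x R)"
    using sep \<rho> patch_subset by (metis dist_self inj_on_def not_less subsetD)
  ultimately show ?thesis by (simp add: finite_image_iff)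
qed

lemma tiling_space_finite_patch:
  assumes "tiling_space \<Omega>" "T \<in> \<Omega>"
  shows "finite (patch T x R)"
proof -
  obtain K where K: "Ball K is_tile \<and> Ball \<Omega> is_tiling \<or> Ball K is_point \<and> Ball \<Omega> is_delone"
    "compact_space (Metric_space.mtopology K tile_dist)" "\<forall>T\<in>\<Omega>. \<forall>t\<in>T. \<exists>k\<in>K. \<exists>x. t = shift_tile x k"
    using assms(1) unfolding tiling_space_def by metis
  from K(1) show ?thesis
  proof
    assume "Ball K is_point \<and> Ball \<Omega> is_delone"
    then show ?thesis using assms(2) by (simp add: finite_patch_delone)
  next
    assume *: "Ball K is_tile \<and> Ball \<Omega> is_tiling"
    from * obtain \<rho> D where \<rho>: "0 < \<rho>" "\<And>k. k \<in> K \<Longrightarrow> \<exists>z. ball z \<rho> \<subseteq> fst k"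
    "\<And>k p q. k \<in> K \<Longrightarrow> p \<in> fst k \<Longrightarrow> q \<in> fst k \<Longrightarrow> dist p q \<le> D"
      using prototiles_uniform_size[of K] K(2) by metis
    show ?thesis
    proof (rule finite_patch_tiling[OF _ \<rho>(1)])
      show "is_tiling T" using * assms(2) by blast
      fix t assume t: "t \<in> T"
      then obtain k v where k: "k \<in> K" "t = shift_tile v k" using K(3) assms(2) by blast
      obtain z where z: "ball z \<rho> \<subseteq> fst k" using \<rho>(2)[OF k(1)] by blast
      have "ball (z - v) \<rho> = (\<lambda>p. p - v) ` ball z \<rho>" using ball_translation_subtract[of z v \<rho>] .
      then show "\<exists>z. ball z \<rho> \<subseteq> fst t" using z k(2) by (metis fst_shift_tile image_mono)
      show "dist p q \<le> D" if "p \<in> fst t" "q \<in> fst t" for p q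
        using that k \<rho>(3)[OF k(1)] by (auto simp: fst_shift_tile dist_norm)
    qed
  qed
qed

lemma tiling_space_compact_tile:
  assumes "tiling_space \<Omega>" "T \<in> \<Omega>" "t \<in> T"
  shows "compact_tile t"
proof -
  have "is_tile t \<or> is_point t"
    using assms unfolding tiling_space_def is_tiling_def is_delone_def by metis
  then show ?thesis
    unfolding compact_tile_def is_tile_def is_point_def using interior_empty polytope_imp_compact by force
qed

lemma tiling_space_pattern_nonempty:
  assumes "tiling_space \<Omega>" "T \<in> \<Omega>"
  shows "T \<noteq> {}"
proof -
  have "is_tiling T \<or> is_delone T" using assms unfolding tiling_space_def by blast
  then show ?thesis by (auto simp: is_tiling_def is_delone_def)
qed

section \<open>The topology of an FLC space\<close>

text \<open>The tilings that agree with \<open>T\<close> on the ball of radius \<open>R\<close> around the origin after a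
  translation by less than \<open>\<delta>\<close>. In an FLC space these sets form a neighbourhood basis of \<open>T\<close>.\<close>

definition nearby ::
    "('a::euclidean_space, 'l) pattern set \<Rightarrow> ('a, 'l) pattern \<Rightarrow> real \<Rightarrow> real \<Rightarrow> ('a, 'l) pattern set" where
  "nearby \<Omega> T R \<delta> = {T' \<in> \<Omega>. \<exists>x. norm x < \<delta> \<and> patch (shift x T') 0 R = patch T 0 R}"

lemma nearbyI: "T' \<in> \<Omega> \<Longrightarrow> norm x < \<delta> \<Longrightarrow> patch (shift x T') 0 R = patch T 0 R \<Longrightarrow> T' \<in> nearby \<Omega> T R \<delta>"
  by (auto simp: nearby_def)

lemma nearbyE:
  assumes "T' \<in> nearby \<Omega> T R \<delta>"
  obtains x where "T' \<in> \<Omega>" "norm x < \<delta>" "patch (shift x T') 0 R = patch T 0 R"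
  using assms by (auto simp: nearby_def)

lemma center_in_nearby: "T \<in> \<Omega> \<Longrightarrow> 0 < \<delta> \<Longrightarrow> T \<in> nearby \<Omega> T R \<delta>"
  by (rule nearbyI[of _ _ 0]) auto

text \<open>The translation itself matches the tiles. The radius exceeds \<open>1 / \<epsilon>\<close> by \<open>\<epsilon>\<close> because a tile of
  \<open>T'\<close> meeting the ball of radius \<open>1 / \<epsilon>\<close> is moved by up to \<open>\<epsilon>\<close>.\<close>

lemma tiling_close_if_patches_agree:
  fixes T T' :: "('a::euclidean_space, 'l::metric_space) pattern"
  assumes ct: "\<And>t. t \<in> T \<Longrightarrow> compact_tile t"
    and x: "norm x < \<epsilon>" and R: "1 / \<epsilon> + \<epsilon> \<le> R"
    and eq: "patch (shift x T') 0 R = patch T 0 R"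
  shows "tiling_close \<epsilon> T T'"
  unfolding tiling_close_def
proof (intro exI conjI ballI)
  have \<epsilon>: "0 < \<epsilon>" using x norm_ge_zero[of x] by linarith
  have b0: "ball 0 (1 / \<epsilon>) \<subseteq> ball (0::'a) R"
    using R \<epsilon> by (auto intro: subset_ball)
  then show "patch T 0 (1 / \<epsilon>) \<subseteq> patch T 0 R" by (rule patch_mono)
  show "patch T 0 R \<subseteq> T" by (rule patch_subset)
  have inj: "inj (shift_tile (- x) :: ('a, 'l) tile \<Rightarrow> _)"
    by (rule inj_on_inverseI[of _ "shift_tile x"]) simp
  show "bij_betw (shift_tile (- x)) (patch T 0 R) (shift (- x) (patch T 0 R))"
    unfolding shift_def by (rule inj_on_imp_bij_betw) (rule inj_on_subset[OF inj subset_UNIV])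
  have e: "shift (- x) (patch T 0 R) = patch T' x R"
    unfolding eq[symmetric] by (simp add: patch_shift)
  then show "shift (- x) (patch T 0 R) \<subseteq> T'" by (simp add: patch_subset)
  have "ball 0 (1 / \<epsilon>) \<subseteq> ball x R"
    using R x by (simp add: ball_subset_ball_iff)
  then show "patch T' 0 (1 / \<epsilon>) \<subseteq> shift (- x) (patch T 0 R)" unfolding e by (rule patch_mono)
  fix t assume "t \<in> patch T 0 R"
  then have "compact_tile t" using ct patch_subset[of T 0 R] by blast
  then show "tile_dist t (shift_tile (- x) t) < \<epsilon>"
    using x by (intro tile_dist_shift_tile_less) auto
qed

lemma openin_imp_nearby:
  fixes \<Omega> :: "('a::euclidean_space, 'l::metric_space) pattern set"
  assumes ct: "\<And>T t. T \<in> \<Omega> \<Longrightarrow> t \<in> T \<Longrightarrow> compact_tile t"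
    and U: "openin (tiling_topology \<Omega>) U" "T \<in> U"
  obtains R \<delta> where "0 < R" "0 < \<delta>" "nearby \<Omega> T R \<delta> \<subseteq> U"
proof -
  have "T \<in> \<Omega>" using U openin_tiling_topology by blast
  obtain \<epsilon> where \<epsilon>: "0 < \<epsilon>" "\<And>T'. T' \<in> \<Omega> \<Longrightarrow> tiling_close \<epsilon> T T' \<Longrightarrow> T' \<in> U"
    using U openin_tiling_topology by metis
  show thesis
  proof
    show "0 < 1 / \<epsilon> + \<epsilon>" using \<epsilon>(1) by (simp add: add_pos_pos)
    show "nearby \<Omega> T (1 / \<epsilon> + \<epsilon>) \<epsilon> \<subseteq> U"
    proof
      fix T' assume "T' \<in> nearby \<Omega> T (1 / \<epsilon> + \<epsilon>) \<epsilon>"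
      then obtain x where x: "T' \<in> \<Omega>" "norm x < \<epsilon>"
        "patch (shift x T') 0 (1 / \<epsilon> + \<epsilon>) = patch T 0 (1 / \<epsilon> + \<epsilon>)" by (rule nearbyE)
      show "T' \<in> U"
        by (rule \<epsilon>(2)[OF x(1) tiling_close_if_patches_agree[OF ct[OF \<open>T \<in> \<Omega>\<close>] x(2) order_refl x(3)]])
    qed
  qed (rule \<epsilon>(1))
qed

lemma continuous_map_nearbyI:
  fixes \<Omega> :: "('a::euclidean_space, 'l::metric_space) pattern set"
  assumes ct: "\<And>T t. T \<in> \<Omega> \<Longrightarrow> t \<in> T \<Longrightarrow> compact_tile t"
    and f: "\<And>z. z \<in> topspace Z \<Longrightarrow> f z \<in> \<Omega>"
    and cont: "\<And>z R \<delta>. z \<in> topspace Z \<Longrightarrow> 0 < R \<Longrightarrow> 0 < \<delta> \<Longrightarrow>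
      \<exists>N. openin Z N \<and> z \<in> N \<and> (\<forall>w\<in>N. f w \<in> nearby \<Omega> (f z) R \<delta>)"
  shows "continuous_map Z (tiling_topology \<Omega>) f"
  unfolding continuous_map_def
proof (intro conjI allI impI)
  fix U assume U: "openin (tiling_topology \<Omega>) U"
  show "openin Z {z \<in> topspace Z. f z \<in> U}"
  proof (subst openin_subopen, rule ballI)
    fix z assume z: "z \<in> {z \<in> topspace Z. f z \<in> U}"
    have fz: "f z \<in> U" using z by simp
    obtain R \<delta> where "0 < R" "0 < \<delta>" and b: "nearby \<Omega> (f z) R \<delta> \<subseteq> U"
      by (rule openin_imp_nearby[OF _ U fz]) (blast intro: ct)+
    then obtain N where N: "openin Z N" "z \<in> N" "\<forall>w\<in>N. f w \<in> nearby \<Omega> (f z) R \<delta>"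
      using cont[of z R \<delta>] z by auto
    then show "\<exists>N. openin Z N \<and> z \<in> N \<and> N \<subseteq> {z \<in> topspace Z. f z \<in> U}"
      using b openin_subset[OF N(1)] by blast
  qed
qed (use f in auto)

text \<open>The corners show that a translation vector bringing \<open>p\<close> close to \<open>t\<close> must be close to
  \<open>corner p - corner t\<close>. So this one vector brings \<open>p\<close> arbitrarily close to \<open>t\<close>.\<close>

lemma translate_if_arbitrarily_close:
  fixes t p :: "('a::euclidean_space, 'l::metric_space) tile"
  assumes c: "compact_tile t" "compact_tile p"
    and close: "\<And>e. 0 < e \<Longrightarrow> \<exists>y. tile_dist t (shift_tile y p) < e"
  shows "shift_tile (corner p - corner t) p = t"
proof -
  let ?y0 = "corner p - corner t" and ?d = "real DIM('a)"
  interpret Metric_space "{t :: ('a, 'l) tile. compact_tile t}" tile_dist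
    by (rule Metric_space_tile_dist) simp
  have "tile_dist t (shift_tile ?y0 p) \<le> 0 + e" if e: "0 < e" for e
  proof -
    define e' where "e' = e / (?d + 2)"
    have e': "0 < e'" "(?d + 2) * e' = e" using e by (auto simp: e'_def)
    obtain y where y: "tile_dist t (shift_tile y p) < e'" using close[OF e'(1)] by blast
    have "norm (corner t - corner (shift_tile y p)) \<le> ?d * e'"
      using norm_corner_diff_le[OF y c(1)] c(2) by simp
    then have "norm (?y0 - y) \<le> ?d * e'"
      using c(2) by (simp add: corner_shift_tile algebra_simps norm_minus_commute)
    then have "norm (?y0 - y) < ?d * e' + e'" using e'(1) by linarith
    from tile_dist_shift_tile_less[OF _ this, of "shift_tile y p"] c(2)
    have "tile_dist (shift_tile y p) (shift_tile ?y0 p) < ?d * e' + e'" by simp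
    moreover have "tile_dist t (shift_tile ?y0 p) \<le>
        tile_dist t (shift_tile y p) + tile_dist (shift_tile y p) (shift_tile ?y0 p)"
      using c by (intro triangle) auto
    ultimately show ?thesis using y e'(2) by (simp add: algebra_simps)
  qed
  then have "tile_dist t (shift_tile ?y0 p) \<le> 0" by (rule field_le_epsilon)
  then have "tile_dist t (shift_tile ?y0 p) = 0" using nonneg[of t "shift_tile ?y0 p"] by linarith
  then show ?thesis using c zero[of t "shift_tile ?y0 p"] by simp
qed

lemma eventually_at_right_0: "(\<exists>b>0. \<forall>y>0. y < b \<longrightarrow> P y) \<Longrightarrow> \<forall>\<^sub>F e in at_right (0::real). P e"
  using eventually_at_right[of 0 1 P] by auto

locale flc_space =
  fixes \<Omega> :: "('a::euclidean_space, 'l::metric_space) pattern set"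
  assumes ts: "tiling_space \<Omega>" and flc: "FLC \<Omega>"
begin

abbreviation X where "X \<equiv> tiling_topology \<Omega>"

lemma shift_in [simp]: "T \<in> \<Omega> \<Longrightarrow> shift x T \<in> \<Omega>"
  using ts by (auto simp: tiling_space_def)

lemma compact_X: "compact_space X"
  using ts by (auto simp: tiling_space_def)

lemma finite_patch: "T \<in> \<Omega> \<Longrightarrow> finite (patch T x R)"
  by (rule tiling_space_finite_patch[OF ts])

lemma compact_tile: "T \<in> \<Omega> \<Longrightarrow> t \<in> T \<Longrightarrow> compact_tile t"
  by (rule tiling_space_compact_tile[OF ts])

text \<open>FLC provides finitely many patches; together with local finiteness this bounds the number of
  tiles occurring in them.\<close>

lemma finitely_many_local_tiles:
  fixes R :: real
  assumes "0 < R"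
  obtains C where "finite C" "\<And>p. p \<in> C \<Longrightarrow> compact_tile p"
    "\<And>T x. T \<in> \<Omega> \<Longrightarrow> \<exists>y. shift y (patch T x R) \<subseteq> C"
proof -
  obtain F where F: "finite F" "\<forall>T\<in>\<Omega>. \<forall>x. \<exists>P\<in>F. \<exists>y. patch T x R = shift y P"
    using flc assms unfolding FLC_def by meson
  let ?C = "\<Union>{P \<in> F. finite P \<and> Ball P compact_tile}"
  show thesis
  proof
    show "finite ?C" using F(1) by auto
    fix T x assume T: "T \<in> \<Omega>"
    then obtain P y where P: "P \<in> F" "patch T x R = shift y P" using F(2) by blast
    then have e: "shift (- y) (patch T x R) = P" by simp
    have "finite (shift (- y) (patch T x R))"
      unfolding shift_def using finite_patch[OF T] by blast
    moreover have "Ball (shift (- y) (patch T x R)) compact_tile"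
    proof
      fix t assume "t \<in> shift (- y) (patch T x R)"
      then obtain u where "u \<in> T" "t = shift_tile (- y) u"
        using patch_subset[of T x R] unfolding shift_def by blast
      then show "compact_tile t" using compact_tile[OF T] by simp
    qed
    ultimately have "P \<in> {P \<in> F. finite P \<and> Ball P compact_tile}" using P(1) unfolding e by simp
    then have "shift (- y) (patch T x R) \<subseteq> ?C" unfolding e by (rule Union_upper)
    then show "\<exists>y. shift y (patch T x R) \<subseteq> ?C" ..
  qed auto
qed

text \<open>Closeness of two tilings matches their tiles one by one, with a small translation for each tile;
  FLC makes these translations equal. The patch of \<open>T'\<close> is a translate of a subset of a fixed finite
  set \<open>C\<close>, so only finitely many pairs \<open>(t, p)\<close> of a tile \<open>t\<close> of \<open>T\<close> and \<open>p \<in> C\<close> have to be considered.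
  For small \<open>\<epsilon>\<close>, a tile \<open>p\<close> that can be moved \<open>\<epsilon>\<close>-close to \<open>t\<close> is a translate of \<open>t\<close>, and the vectors
  \<open>corner p - corner t\<close> of two such pairs are either equal or further apart than closeness permits.\<close>

lemma patches_agree_if_tiling_close:
  assumes T: "T \<in> \<Omega>" and R: "0 < R" and \<delta>: "0 < \<delta>"
  obtains \<epsilon> where "0 < \<epsilon>" "\<And>T'. T' \<in> \<Omega> \<Longrightarrow> tiling_close \<epsilon> T T' \<Longrightarrow> T' \<in> nearby \<Omega> T R \<delta>"
proof -
  let ?d = "real DIM('a)"
  define Q where "Q = patch T 0 (R + 1)"
  have finQ: "finite Q" unfolding Q_def by (rule finite_patch[OF T])
  have ctQ: "compact_tile t" if "t \<in> Q" for t
    using compact_tile[OF T] that patch_subset unfolding Q_def by blast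
  obtain C where finC: "finite C" and ctC: "\<And>p. p \<in> C \<Longrightarrow> compact_tile p"
    and C: "\<And>T x. T \<in> \<Omega> \<Longrightarrow> \<exists>y. shift y (patch T x (R + 2)) \<subseteq> C"
    using finitely_many_local_tiles[of "R + 2"] R by auto
  define off where "off t p = corner p - corner t" for t p :: "('a, 'l) tile"
  have 1: "\<forall>\<^sub>F e in at_right 0. \<forall>t\<in>Q. \<forall>p\<in>C. \<forall>y. tile_dist t (shift_tile y p) < e \<longrightarrow> shift_tile (off t p) p = t"
  proof (intro eventually_ball_finite ballI finQ finC)
    fix t p assume tp: "t \<in> Q" "p \<in> C"
    show "\<forall>\<^sub>F e in at_right 0. \<forall>y. tile_dist t (shift_tile y p) < e \<longrightarrow> shift_tile (off t p) p = t"
    proof (cases "shift_tile (off t p) p = t")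
      case False
      then obtain b where b: "0 < b" "\<And>y. \<not> tile_dist t (shift_tile y p) < b"
        using translate_if_arbitrarily_close[of t p] ctQ ctC tp unfolding off_def by blast
      show ?thesis
        using b by (intro eventually_at_right_0 exI[of _ b]) (meson less_trans)
    qed simp
  qed
  have 2: "\<forall>\<^sub>F e in at_right 0. \<forall>t\<in>Q. \<forall>p\<in>C. \<forall>t'\<in>Q. \<forall>p'\<in>C.
      norm (off t p - off t' p') \<le> 2 * ?d * e \<longrightarrow> off t p = off t' p'"
  proof (intro eventually_ball_finite ballI finQ finC)
    fix t p t' p'
    let ?n = "norm (off t p - off t' p')"
    show "\<forall>\<^sub>F e in at_right 0. ?n \<le> 2 * ?d * e \<longrightarrow> off t p = off t' p'"
    proof (cases "off t p = off t' p'")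
      case False
      show ?thesis
        by (rule eventually_at_right_0, rule exI[of _ "?n / (2 * ?d)"])
          (use False in \<open>auto simp: field_simps\<close>)
    qed simp
  qed
  have 3: "\<forall>\<^sub>F e in at_right 0. 0 < e \<and> (?d + 1) * e < min \<delta> 1 \<and> R + 1 \<le> 1 / e"
    by (rule eventually_at_right_0, rule exI[of _ "min (min \<delta> 1 / (?d + 1)) (1 / (R + 1))"])
      (use R \<delta> in \<open>auto simp: field_simps\<close>)
  from eventually_happens'[OF trivial_limit_at_right_real eventually_conj[OF 1 eventually_conj[OF 2 3]]]
  obtain e where
    e1: "\<forall>t\<in>Q. \<forall>p\<in>C. \<forall>y. tile_dist t (shift_tile y p) < e \<longrightarrow> shift_tile (off t p) p = t"
    and e2: "\<forall>t\<in>Q. \<forall>p\<in>C. \<forall>t'\<in>Q. \<forall>p'\<in>C.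
      norm (off t p - off t' p') \<le> 2 * ?d * e \<longrightarrow> off t p = off t' p'"
    and e: "0 < e" "(?d + 1) * e < min \<delta> 1" "R + 1 \<le> 1 / e"
    by blast
  have sep1: "shift_tile (off t p) p = t"
    if "t \<in> Q" "p \<in> C" "tile_dist t (shift_tile y p) < e" for t p y
    using e1 that by blast
  have sep2: "off t p = off t' p'"
    if "t \<in> Q" "p \<in> C" "t' \<in> Q" "p' \<in> C" "norm (off t p - off t' p') \<le> 2 * ?d * e" for t p t' p'
    using e2 that by blast
  show thesis
  proof
    show "0 < e" by (rule e(1))
    fix T' assume T': "T' \<in> \<Omega>" and "tiling_close e T T'"
    then obtain A A' \<beta> where A: "patch T 0 (1 / e) \<subseteq> A" "A \<subseteq> T" "patch T' 0 (1 / e) \<subseteq> A'" "A' \<subseteq> T'"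
      and \<beta>: "bij_betw \<beta> A A'" "\<And>t. t \<in> A \<Longrightarrow> tile_dist t (\<beta> t) < e"
      unfolding tiling_close_def by metis
    have ctA: "compact_tile t" "compact_tile (\<beta> t)" "\<beta> t \<in> T'" if "t \<in> A" for t
    proof -
      show "\<beta> t \<in> T'" using bij_betwE[OF \<beta>(1)] that A(4) by blast
      then show "compact_tile (\<beta> t)" by (rule compact_tile[OF T'])
      show "compact_tile t" using compact_tile[OF T] that A(2) by blast
    qed
    have "Q \<subseteq> A" unfolding Q_def using A(1) e(3)
      by (meson order_trans patch_mono subset_ball)
    \<comment> \<open>\<open>p t\<close> is the tile of \<open>C\<close> that represents the partner \<open>\<beta> t\<close> of \<open>t\<close>.\<close>
    obtain y0 where y0: "shift y0 (patch T' 0 (R + 2)) \<subseteq> C" using C[OF T'] by blast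
    define p where "p t = shift_tile y0 (\<beta> t)" for t
    have \<beta>p: "\<beta> t = shift_tile (- y0) (p t)" for t by (simp add: p_def)
    have "(?d + 1) * e = ?d * e + e" by (simp add: algebra_simps)
    then have de: "?d * e + e < \<delta>" "?d * e + e < 1" using e(2) by auto
    have pC: "p t \<in> C" if "t \<in> Q" for t
    proof -
      have tA: "t \<in> A" using that \<open>Q \<subseteq> A\<close> by blast
      from that obtain a where a: "a \<in> fst t" "norm a < R + 1" unfolding Q_def patch_def by auto
      obtain b where b: "b \<in> fst (\<beta> t)" "dist a b < e"
        using tile_dist_lessD(1)[OF \<beta>(2) _ _ a(1)] ctA tA by blast
      have "norm b \<le> norm a + dist a b" by (metis add.commute dist_commute dist_norm norm_triangle_sub)
      also have "0 \<le> ?d * e" using e(1) by simp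
      then have "norm a + dist a b < R + 2" using a b(2) de(2) by linarith
      finally have "\<beta> t \<in> patch T' 0 (R + 2)"
        using b(1) ctA(3)[OF tA] by (auto simp: patch_def)
      then show ?thesis using y0 unfolding p_def shift_def by blast
    qed
    have close_p: "tile_dist t (shift_tile (- y0) (p t)) < e" if "t \<in> Q" for t
      using \<beta>(2)[of t] that \<open>Q \<subseteq> A\<close> by (auto simp: \<beta>p)
    have off_p: "norm (off t (p t) + y0) \<le> ?d * e" if t: "t \<in> Q" for t
      using norm_corner_diff_le[OF close_p[OF t]] ctQ[OF t] ctC[OF pC[OF t]]
      by (simp add: corner_shift_tile off_def norm_minus_commute algebra_simps)
    have "off t (p t) = off t' (p t')" if "t \<in> Q" "t' \<in> Q" for t t'
    proof (rule sep2)
      have "norm (off t (p t) - off t' (p t')) \<le> norm (off t (p t) + y0) + norm (off t' (p t') + y0)"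
        using norm_triangle_ineq4[of "off t (p t) + y0" "off t' (p t') + y0"] by simp
      then show "norm (off t (p t) - off t' (p t')) \<le> 2 * ?d * e"
        using off_p[OF that(1)] off_p[OF that(2)] by linarith
    qed (use that pC in auto)
    \<comment> \<open>All partners are moved to their tiles by the same vector \<open>y1 + y0\<close>.\<close>
    then obtain y1 where y1: "\<And>t. t \<in> Q \<Longrightarrow> off t (p t) = y1" by metis
    obtain x where x: "norm x \<le> ?d * e" "\<And>t. t \<in> Q \<Longrightarrow> shift_tile x (\<beta> t) = t"
    proof (cases "Q = {}")
      case True
      then show thesis using that[of 0] e(1) by simp
    next
      case False
      show thesis
      proof (rule that[of "y1 + y0"])
        show "norm (y1 + y0) \<le> ?d * e" using False y1 off_p by fastforce
        fix t assume t: "t \<in> Q"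
        show "shift_tile (y1 + y0) (\<beta> t) = t"
          using sep1[OF t pC[OF t] close_p[OF t]] y1[OF t] by (simp add: p_def add.commute)
      qed
    qed
    show "T' \<in> nearby \<Omega> T R \<delta>"
    proof (rule nearbyI[OF T'])
      show "norm x < \<delta>" using x(1) de e(1) by linarith
      show "patch (shift x T') 0 R = patch T 0 R"
      proof (intro subset_antisym subsetI)
        fix t assume t: "t \<in> patch T 0 R"
        then have "t \<in> Q" unfolding Q_def by (auto simp: patch_def)
        then have "shift_tile (- x) t = \<beta> t" using x(2)[of t]
          by (metis shift_tile_shift_tile shift_tile_0 add.left_inverse)
        then have "t \<in> shift x T'" using ctA(3)[of t] \<open>t \<in> Q\<close> \<open>Q \<subseteq> A\<close> by (auto simp: mem_shift_iff)
        then show "t \<in> patch (shift x T') 0 R" using t by (simp add: patch_def)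
      next
        fix u assume u: "u \<in> patch (shift x T') 0 R"
        define u' where "u' = shift_tile (- x) u"
        have uu': "u = shift_tile x u'" by (simp add: u'_def)
        have "u' \<in> T'" using u by (auto simp: patch_def mem_shift_iff u'_def)
        obtain b where b: "b \<in> fst u'" "norm (b - x) < R"
          using u unfolding uu' by (auto simp: patch_def fst_shift_tile)
        have "norm b < R + norm x" using b(2) norm_triangle_sub[of b x] by linarith
        then have nb: "norm b < R + ?d * e" using x(1) by linarith
        also have "\<dots> \<le> 1 / e" using de e(1,3) by linarith
        finally have "u' \<in> patch T' 0 (1 / e)" using b(1) \<open>u' \<in> T'\<close> by (auto simp: patch_def)
        then have "u' \<in> A'" using A(3) by blast
        then obtain t where t: "t \<in> A" "u' = \<beta> t" using \<beta>(1) by (auto simp: bij_betw_def)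
        obtain a where a: "a \<in> fst t" "dist a b < e"
          using tile_dist_lessD(2)[OF \<beta>(2)] ctA t b(1) by blast
        have "norm a \<le> norm b + dist a b" by (metis dist_norm norm_triangle_sub)
        then have "norm a < R + 1" using nb a(2) de(2) by linarith
        then have "t \<in> Q" unfolding Q_def using a(1) t(1) A(2) by (auto simp: patch_def)
        then have "u = t" using x(2) uu' t(2) by simp
        then show "u \<in> patch T 0 R" using u t(1) A(2) by (auto simp: patch_def)
      qed
    qed
  qed
qed

lemma openin_nearby_iff:
  "openin X U \<longleftrightarrow> U \<subseteq> \<Omega> \<and> (\<forall>T\<in>U. \<exists>R>0. \<exists>\<delta>>0. nearby \<Omega> T R \<delta> \<subseteq> U)" (is "?L \<longleftrightarrow> ?R")
proof
  assume L: ?L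
  have "\<exists>R>0. \<exists>\<delta>>0. nearby \<Omega> T R \<delta> \<subseteq> U" if "T \<in> U" for T
    by (rule openin_imp_nearby[OF compact_tile L that]) blast+
  then show ?R using openin_subset[OF L] by auto
next
  assume R: ?R
  have "\<exists>\<epsilon>>0. \<forall>T'\<in>\<Omega>. tiling_close \<epsilon> T T' \<longrightarrow> T' \<in> U" if T: "T \<in> U" for T
  proof -
    obtain R \<delta> where b: "0 < R" "0 < \<delta>" "nearby \<Omega> T R \<delta> \<subseteq> U" using R T by blast
    have "T \<in> \<Omega>" using R T by blast
    from patches_agree_if_tiling_close[OF this b(1,2)] show ?thesis using b(3) by (metis subsetD)
  qed
  then show ?L using R by (simp add: openin_tiling_topology)
qed

lemma openin_nearby:
  assumes "T \<in> \<Omega>" "0 < R"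
  shows "openin X (nearby \<Omega> T R \<delta>)"
  unfolding openin_nearby_iff
proof (intro conjI ballI)
  show "nearby \<Omega> T R \<delta> \<subseteq> \<Omega>" by (auto simp: nearby_def)
  fix T' assume "T' \<in> nearby \<Omega> T R \<delta>"
  then obtain x where x: "T' \<in> \<Omega>" "norm x < \<delta>" "patch (shift x T') 0 R = patch T 0 R" by (rule nearbyE)
  show "\<exists>R'>0. \<exists>\<delta>'>0. nearby \<Omega> T' R' \<delta>' \<subseteq> nearby \<Omega> T R \<delta>"
  proof (intro exI conjI subsetI)
    show "0 < R + norm x" "0 < \<delta> - norm x" using assms(2) x(2) by (auto simp: add_pos_nonneg)
    fix T'' assume "T'' \<in> nearby \<Omega> T' (R + norm x) (\<delta> - norm x)"
    then obtain y where y: "T'' \<in> \<Omega>" "norm y < \<delta> - norm x"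
      "patch (shift y T'') 0 (R + norm x) = patch T' 0 (R + norm x)" by (rule nearbyE)
    show "T'' \<in> nearby \<Omega> T R \<delta>"
    proof (rule nearbyI[OF y(1)])
      show "norm (x + y) < \<delta>" using norm_triangle_ineq[of x y] y(2) by linarith
      show "patch (shift (x + y) T'') 0 R = patch T 0 R"
        using patch_shift_cong[OF y(3), of x R] x(3) by simp
    qed
  qed
qed

text \<open>Joint continuity, which is needed for homotopies along the orbits.\<close>

lemma continuous_map_shift:
  "continuous_map (prod_topology euclidean X) X (\<lambda>(v, T). shift v T)"
proof (rule continuous_map_nearbyI[OF compact_tile])
  fix z :: "'a \<times> ('a, 'l) pattern" and R \<delta> :: real
  assume z: "z \<in> topspace (prod_topology euclidean X)" and R: "0 < R" and \<delta>: "0 < \<delta>"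
  obtain v T where vT: "z = (v, T)" "T \<in> \<Omega>" using z by (cases z) auto
  let ?R = "R + norm v" and ?N = "ball v (\<delta>/2) \<times> nearby \<Omega> T (R + norm v) (\<delta>/2)"
  have R': "0 < ?R" using R by (simp add: add_pos_nonneg)
  show "\<exists>N. openin (prod_topology euclidean X) N \<and> z \<in> N \<and>
      (\<forall>w\<in>N. (case w of (v, T) \<Rightarrow> shift v T) \<in> nearby \<Omega> (case z of (v, T) \<Rightarrow> shift v T) R \<delta>)"
  proof (intro exI[of _ ?N] conjI ballI)
    show "openin (prod_topology euclidean X) ?N"
      using openin_nearby[OF vT(2) R'] by (simp add: openin_prod_Times_iff)
    show "z \<in> ?N" using center_in_nearby[OF vT(2), of "\<delta>/2"] \<delta> by (simp add: vT(1))
    fix w assume "w \<in> ?N"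
    then obtain v' T' where w: "w = (v', T')" "dist v v' < \<delta>/2" "T' \<in> nearby \<Omega> T ?R (\<delta>/2)" by auto
    from w(3) obtain x where x: "T' \<in> \<Omega>" "norm x < \<delta>/2" "patch (shift x T') 0 ?R = patch T 0 ?R"
      by (rule nearbyE)
    have "shift v' T' \<in> nearby \<Omega> (shift v T) R \<delta>"
    proof (rule nearbyI)
      show "norm (x + (v - v')) < \<delta>"
        using norm_triangle_ineq[of x "v - v'"] w(2) x(2) by (simp add: dist_norm)
      show "patch (shift (x + (v - v')) (shift v' T')) 0 R = patch (shift v T) 0 R"
        using patch_shift_cong[OF x(3), of v R] by (simp add: algebra_simps)
    qed (use x in auto)
    then show "(case w of (v, T) \<Rightarrow> shift v T) \<in> nearby \<Omega> (case z of (v, T) \<Rightarrow> shift v T) R \<delta>"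
      by (simp add: w vT)
  qed
qed auto

text \<open>Translates of one tile by infinitely many short vectors would contradict local finiteness.\<close>

lemma small_return_is_zero:
  fixes t :: "('a, 'l) tile"
  assumes T: "T \<in> \<Omega>"
  obtains \<rho> where "0 < \<rho>" "\<And>z. norm z < \<rho> \<Longrightarrow> shift_tile z t \<in> T \<Longrightarrow> z = 0"
proof (cases "\<exists>z. shift_tile z t \<in> T")
  case False
  then show thesis using that[of 1] by auto
next
  case True
  then have ct: "compact_tile t" using compact_tile[OF T] compact_tile_shift_tile by metis
  then obtain q where q: "q \<in> fst t" by (auto simp: compact_tile_def)
  define Z where "Z = {z. norm z < 1 \<and> shift_tile z t \<in> T}"
  have "shift_tile z t \<in> patch T 0 (norm q + 1)" if "z \<in> Z" for z
  proof -
    have "q - z \<in> fst (shift_tile z t) \<inter> ball 0 (norm q + 1)"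
      using q that norm_triangle_ineq4[of q z] by (auto simp: Z_def fst_shift_tile)
    then show ?thesis using that by (auto simp: Z_def patch_def)
  qed
  then have "finite ((\<lambda>z. shift_tile z t) ` Z)"
    by (intro finite_subset[OF _ finite_patch[OF T, of 0 "norm q + 1"]]) auto
  moreover have "inj_on (\<lambda>z. shift_tile z t) Z"
    using corner_shift_tile[OF ct] by (intro inj_on_inverseI[of _ "\<lambda>u. corner t - corner u"]) simp
  ultimately have "finite Z" by (simp add: finite_image_iff)
  then have fin: "finite (insert 1 (norm ` (Z - {0})))" by simp
  define \<rho> where "\<rho> = Min (insert 1 (norm ` (Z - {0})))"
  show thesis
  proof (rule that[of \<rho>])
    show "0 < \<rho>" unfolding \<rho>_def using fin by (subst Min_gr_iff) auto
    fix z assume z: "norm z < \<rho>" "shift_tile z t \<in> T"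
    have "\<rho> \<le> 1" unfolding \<rho>_def using fin by simp
    then have "z \<in> Z" using z by (simp add: Z_def)
    show "z = 0"
    proof (rule ccontr)
      assume "z \<noteq> 0"
      then have "\<rho> \<le> norm z" unfolding \<rho>_def using fin \<open>z \<in> Z\<close> by (intro Min_le) auto
      then show False using z(1) by simp
    qed
  qed
qed

text \<open>If a third tiling agrees with both \<open>T\<close> and \<open>T'\<close> up to small translations, then a tile of \<open>T\<close>
  has translates by arbitrarily short vectors in \<open>T'\<close>; by local finiteness the tile itself lies
  in \<open>T'\<close>.\<close>

lemma subset_if_not_separated:
  assumes T: "T \<in> \<Omega>" and T': "T' \<in> \<Omega>"
    and near: "\<And>R \<delta>. 0 < R \<Longrightarrow> 0 < \<delta> \<Longrightarrow> nearby \<Omega> T R \<delta> \<inter> nearby \<Omega> T' R \<delta> \<noteq> {}"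
  shows "T \<subseteq> T'"
proof
  fix t assume t: "t \<in> T"
  then obtain q where q: "q \<in> fst t" using compact_tile[OF T, of t] unfolding compact_tile_def by blast
  obtain \<rho> where \<rho>: "0 < \<rho>" "\<And>z. norm z < \<rho> \<Longrightarrow> shift_tile z t \<in> T' \<Longrightarrow> z = 0"
    using small_return_is_zero[OF T', of t] by metis
  define R where "R = norm q + \<rho> + 1"
  have R: "0 < R" using \<rho>(1) norm_ge_zero[of q] unfolding R_def by linarith
  obtain S where S: "S \<in> nearby \<Omega> T R (\<rho>/2)" "S \<in> nearby \<Omega> T' R (\<rho>/2)" using near[OF R, of "\<rho>/2"] \<rho>(1) by auto
  obtain x where x: "norm x < \<rho>/2" "patch (shift x S) 0 R = patch T 0 R" using S(1) by (rule nearbyE)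
  obtain y where y: "norm y < \<rho>/2" "patch (shift y S) 0 R = patch T' 0 R" using S(2) by (rule nearbyE)
  have n: "norm (y - x) < \<rho>" using x(1) y(1) norm_triangle_ineq4[of y x] by linarith
  have "t \<in> patch T 0 R" using t q \<rho>(1) by (auto simp: patch_def R_def)
  then have "t \<in> shift x S" using x(2) patch_subset by blast
  then have "shift_tile (y - x) t \<in> shift y S" by (simp add: mem_shift_iff)
  moreover have "q - (y - x) \<in> fst (shift_tile (y - x) t) \<inter> ball 0 R"
    using q n norm_triangle_ineq4[of q "y - x"] by (auto simp: fst_shift_tile R_def)
  ultimately have "shift_tile (y - x) t \<in> patch (shift y S) 0 R" by (auto simp: patch_def)
  then have *: "shift_tile (y - x) t \<in> T'" using y(2) patch_subset by blast
  with \<rho>(2)[OF n] have "y - x = 0" by simp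
  with * show "t \<in> T'" by simp
qed

lemma Hausdorff_X: "Hausdorff_space X"
  unfolding Hausdorff_space_def
proof (intro allI impI, elim conjE)
  fix T T' assume T: "T \<in> topspace X" "T' \<in> topspace X" "T \<noteq> T'"
  have "\<exists>R>0. \<exists>\<delta>>0. nearby \<Omega> T R \<delta> \<inter> nearby \<Omega> T' R \<delta> = {}"
  proof (rule ccontr)
    assume "\<not> ?thesis"
    then have *: "nearby \<Omega> T R \<delta> \<inter> nearby \<Omega> T' R \<delta> \<noteq> {}" if "0 < R" "0 < \<delta>" for R \<delta> using that by blast
    have "T \<subseteq> T'" using T * by (intro subset_if_not_separated) auto
    moreover have "T' \<subseteq> T" using T * by (intro subset_if_not_separated) (auto simp: Int_commute)
    ultimately show False using T(3) by blast
  qed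
  then obtain R \<delta> where "0 < R" "0 < \<delta>" "disjnt (nearby \<Omega> T R \<delta>) (nearby \<Omega> T' R \<delta>)" by (auto simp: disjnt_def)
  then show "\<exists>U V. openin X U \<and> openin X V \<and> T \<in> U \<and> T' \<in> V \<and> disjnt U V"
    using T openin_nearby center_in_nearby
    by (intro exI[of _ "nearby \<Omega> T R \<delta>"] exI[of _ "nearby \<Omega> T' R \<delta>"]) auto
qed

end

section \<open>Flow boxes and their coordinates\<close>

text \<open>The point \<open>-a\<close> of the Delone set \<open>D T\<close> that puts \<open>T\<close> at position \<open>a\<close> of the flow box is determined by a
  patch of \<open>T\<close>, because \<open>D\<close> is a local derivation. A tiling agreeing with \<open>T\<close> up to a small translation
  has the correspondingly translated point.\<close>

lemma flow_box_chart:
  fixes \<Omega> :: "('a::euclidean_space, 'l::metric_space) pattern set"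
  assumes ts: "tiling_space \<Omega>" and tr: "FLC_transversal \<Omega> \<Xi>" and T: "T \<in> flow_box \<Xi> \<epsilon>"
  obtains R \<delta> where "0 < R" "0 < \<delta>"
    "\<And>T' x. T' \<in> \<Omega> \<Longrightarrow> norm x < \<delta> \<Longrightarrow> patch (shift x T') 0 R = patch T 0 R \<Longrightarrow>
      \<exists>S\<in>\<Xi>. \<exists>S'\<in>\<Xi>. \<exists>a. T = shift a S \<and> T' = shift (a - x) S' \<and> norm a < \<epsilon> \<and> norm (a - x) < \<epsilon>"
proof -
  have sh: "shift v S \<in> \<Omega>" if "S \<in> \<Omega>" for S v using ts that by (auto simp: tiling_space_def)
  obtain \<Omega>0 :: "('a, 'l) pattern set" and D where D: "local_derivation \<Omega> \<Omega>0 D"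
    and \<Xi>: "\<Xi> = {T \<in> \<Omega>. D T \<in> canonical_transversal \<Omega>0}"
    using tr unfolding FLC_transversal_def by metis
  have eqv: "D (shift x S) = shift x (D S)" if "S \<in> \<Omega>" for S x
    using D that by (auto simp: local_derivation_def factor_map_def)
  have D\<Omega>0: "D S \<in> \<Omega>0" if "S \<in> \<Omega>" for S
    using D that by (auto simp: local_derivation_def factor_map_def)
  obtain S a where S: "S \<in> \<Xi>" "norm a < \<epsilon>" "T = shift a S" using T by (auto simp: flow_box_def)
  then obtain l where l: "({0}, l) \<in> D S" and S\<Omega>: "S \<in> \<Omega>" by (auto simp: \<Xi> canonical_transversal_def)
  have T\<Omega>: "T \<in> \<Omega>" using S(3) sh S\<Omega> by simp
  have "({- a}, l) \<in> D T" using l by (simp add: S(3) eqv[OF S\<Omega>] mem_shift_iff shift_tile_def)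
  then have la: "({- a}, l) \<in> patch (D T) 0 (norm a + 1)" by (simp add: patch_def)
  have "0 < norm a + 1" by (simp add: add_nonneg_pos)
  then obtain R where R: "0 < R" "\<And>T'. T' \<in> \<Omega> \<Longrightarrow> patch T 0 R = patch T' 0 R \<Longrightarrow>
      patch (D T) 0 (norm a + 1) = patch (D T') 0 (norm a + 1)"
    using D T\<Omega> unfolding local_derivation_def by meson
  show thesis
  proof (rule that[OF R(1)])
    show "0 < \<epsilon> - norm a" using S(2) by simp
    fix T' x assume T': "T' \<in> \<Omega>" and x: "norm x < \<epsilon> - norm a"
      and eq: "patch (shift x T') 0 R = patch T 0 R"
    have "({- a}, l) \<in> D (shift x T')"
      using R(2)[OF sh[OF T'] eq[symmetric]] la by (auto simp: patch_def)
    then have "({0}, l) \<in> D (shift (x - a) T')"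
      using eqv[OF T'] by (simp add: mem_shift_iff shift_tile_def add.commute)
    then have "shift (x - a) T' \<in> \<Xi>"
      using sh[OF T'] D\<Omega>0[OF sh[OF T']] by (auto simp: \<Xi> canonical_transversal_def)
    moreover have "T' = shift (a - x) (shift (x - a) T')" by simp
    moreover have "norm (a - x) < \<epsilon>" using x norm_triangle_ineq4[of a x] by linarith
    ultimately show "\<exists>S\<in>\<Xi>. \<exists>S'\<in>\<Xi>. \<exists>a. T = shift a S \<and> T' = shift (a - x) S' \<and> norm a < \<epsilon> \<and> norm (a - x) < \<epsilon>"
      using S by blast
  qed
qed

abbreviation box_coord ::
    "('a::euclidean_space, 'l) pattern set \<Rightarrow> real \<Rightarrow> ('a, 'l) pattern \<Rightarrow> 'a" where
  "box_coord \<equiv> flow_box_fun (\<lambda>T v. v)"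

lemma box_coord_eq:
  fixes \<Xi> :: "('a::euclidean_space, 'l) pattern set"
  assumes inj: "inj_on (\<lambda>(S, x). shift x S) (\<Xi> \<times> ball 0 \<epsilon>)" and "S \<in> \<Xi>" "norm a < \<epsilon>"
  shows "box_coord \<Xi> \<epsilon> (shift a S) = a"
  unfolding flow_box_fun_def
proof (rule the_equality)
  fix c assume "\<exists>S' x. S' \<in> \<Xi> \<and> norm x < \<epsilon> \<and> shift a S = shift x S' \<and> c = x"
  then obtain S' where S': "S' \<in> \<Xi>" "norm c < \<epsilon>" "shift a S = shift c S'" by blast
  have "(S, a) = (S', c)" by (rule inj_onD[OF inj]) (use S' assms in auto)
  then show "c = a" by simp
qed (use assms in auto)

lemma box_coord_chart:
  fixes \<Omega> :: "('a::euclidean_space, 'l::metric_space) pattern set"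
  assumes ts: "tiling_space \<Omega>" and ofb: "open_flow_box \<Omega> \<Xi> \<epsilon>" and T: "T \<in> flow_box \<Xi> \<epsilon>"
  obtains R \<delta> where "0 < R" "0 < \<delta>"
    "\<And>T' x. T' \<in> \<Omega> \<Longrightarrow> norm x < \<delta> \<Longrightarrow> patch (shift x T') 0 R = patch T 0 R \<Longrightarrow>
      box_coord \<Xi> \<epsilon> T' = box_coord \<Xi> \<epsilon> T - x"
proof -
  have tr: "FLC_transversal \<Omega> \<Xi>" and inj: "inj_on (\<lambda>(S, x). shift x S) (\<Xi> \<times> ball 0 \<epsilon>)"
    using ofb by (auto simp: open_flow_box_def)
  obtain R \<delta> where R: "0 < R" "0 < \<delta>" and
    c: "\<And>T' x. T' \<in> \<Omega> \<Longrightarrow> norm x < \<delta> \<Longrightarrow> patch (shift x T') 0 R = patch T 0 R \<Longrightarrow>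
      \<exists>S\<in>\<Xi>. \<exists>S'\<in>\<Xi>. \<exists>a. T = shift a S \<and> T' = shift (a - x) S' \<and> norm a < \<epsilon> \<and> norm (a - x) < \<epsilon>"
    by (rule flow_box_chart[OF ts tr T]) blast
  show thesis
  proof (rule that[OF R])
    fix T' x assume "T' \<in> \<Omega>" "norm x < \<delta>" "patch (shift x T') 0 R = patch T 0 R"
    from c[OF this] obtain S S' a where "S \<in> \<Xi>" "S' \<in> \<Xi>" "T = shift a S" "T' = shift (a - x) S'"
      "norm a < \<epsilon>" "norm (a - x) < \<epsilon>" by blast
    then show "box_coord \<Xi> \<epsilon> T' = box_coord \<Xi> \<epsilon> T - x"
      using box_coord_eq[OF inj] by simp
  qed
qed


section \<open>Existence of flow boxes\<close>

text \<open>The positions where \<open>T\<close> looks like \<open>P\<close> around the origin, as points with a constant label. The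
  canonical transversal of the resulting Delone space pulls back to the tilings agreeing with \<open>P\<close> on the ball of radius \<open>R\<close>.\<close>

definition occurrences :: "real \<Rightarrow> ('a::euclidean_space, 'l) pattern \<Rightarrow> ('a, 'l) pattern \<Rightarrow> ('a, 'l) pattern" where
  "occurrences R P T = {({x}, undefined) | x. patch (shift x T) 0 R = patch P 0 R}"

lemma mem_occurrences: "(A, l) \<in> occurrences R P T \<longleftrightarrow>
    (\<exists>x. A = {x} \<and> l = undefined \<and> patch (shift x T) 0 R = patch P 0 R)"
  unfolding occurrences_def by (simp only: mem_Collect_eq prod.inject conj_assoc)

lemma occurrences_shift: "occurrences R P (shift v T) = shift v (occurrences R P T)"
proof -
  have reindex: "{F x | x. Q (x + v)} = {F (x - v) | x. Q x}" for F :: "'a \<Rightarrow> ('a, 'l) tile" and Q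
    by (metis (no_types, opaque_lifting) add_diff_cancel_right' diff_add_cancel)
  have "occurrences R P (shift v T) = {({x}, undefined) | x. patch (shift (x + v) T) 0 R = patch P 0 R}"
    by (simp add: occurrences_def)
  also have "\<dots> = {({x - v}, undefined) | x. patch (shift x T) 0 R = patch P 0 R}"
    by (rule reindex)
  also have "\<dots> = (\<lambda>t. shift_tile v t) ` {({x}, undefined) | x. patch (shift x T) 0 R = patch P 0 R}"
    by (simp add: setcompr_eq_image image_image shift_tile_def)
  also have "\<dots> = shift v (occurrences R P T)" by (simp only: shift_def occurrences_def)
  finally show ?thesis .
qed

lemma occurrences_local:
  assumes "patch T 0 (R + r) = patch T' 0 (R + r)"
  shows "patch (occurrences R P T) 0 r = patch (occurrences R P T') 0 r"
proof -
  have "patch (shift x T) 0 R = patch (shift x T') 0 R" if "norm x < r" for x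
    using patch_shift_cong[OF assms, of x R] that by simp
  then show ?thesis by (auto simp: patch_def occurrences_def)
qed

lemma compact_tile_occurrences: "t \<in> occurrences R P T \<Longrightarrow> compact_tile t"
  by (auto simp: occurrences_def compact_tile_def)

context flc_space
begin

lemma continuous_map_shift_by: "continuous_map X X (shift v)"
proof -
  have "continuous_map X (prod_topology euclidean X) (\<lambda>T. (v, T))"
    by (simp add: continuous_map_pairedI)
  from continuous_map_compose[OF this continuous_map_shift] show ?thesis by (simp add: o_def)
qed

text \<open>By minimality every tiling has a translate near \<open>P\<close>, and by compactness finitely many
  translations suffice.\<close>

lemma repetitive:
  assumes min: "minimal \<Omega>" and P: "P \<in> \<Omega>" and R: "0 < R"
  obtains M where "0 < M" "\<And>T. T \<in> \<Omega> \<Longrightarrow> \<exists>v. norm v \<le> M \<and> patch (shift v T) 0 R = patch P 0 R"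
proof -
  define U where "U v = {T \<in> topspace X. shift v T \<in> nearby \<Omega> P R 1}" for v
  have openU: "openin X (U v)" for v
    unfolding U_def by (rule openin_continuous_map_preimage[OF continuous_map_shift_by openin_nearby[OF P R]])
  have cover: "\<Omega> \<subseteq> \<Union>(range U)"
  proof
    fix T assume T: "T \<in> \<Omega>"
    then have "P \<in> X closure_of (range (\<lambda>x. shift x T))" using min P by (auto simp: minimal_def)
    then obtain v where "shift v T \<in> nearby \<Omega> P R 1"
      using openin_nearby[OF P R, of 1] center_in_nearby[OF P, of 1] by (auto simp: in_closure_of)
    then show "T \<in> \<Union>(range U)" using T by (auto simp: U_def)
  qed
  have "\<forall>W\<in>range U. openin X W" using openU by blast
  then obtain F where F: "finite F" "F \<subseteq> range U" "\<Omega> \<subseteq> \<Union>F"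
    using compact_X cover unfolding compact_space_alt topspace_tiling_topology by meson
  obtain V where V: "finite V" "\<Omega> \<subseteq> (\<Union>v\<in>V. U v)"
    using finite_subset_image[OF F(1,2)] F(3) by blast
  define M where "M = Max (insert 0 (norm ` V)) + 1"
  have M: "norm v + 1 \<le> M" if "v \<in> V" for v
    unfolding M_def using V(1) that by (simp add: Max_ge)
  show thesis
  proof
    have "0 \<le> Max (insert 0 (norm ` V))" using V(1) by (intro Max_ge) auto
    then show "0 < M" by (simp add: M_def)
    fix T assume "T \<in> \<Omega>"
    then obtain v where v: "v \<in> V" "shift v T \<in> nearby \<Omega> P R 1" using V(2) by (auto simp: U_def)
    from v(2) obtain x where x: "norm x < 1" "patch (shift x (shift v T)) 0 R = patch P 0 R" by (rule nearbyE)
    have "norm (x + v) \<le> M" using M[OF v(1)] x(1) norm_triangle_ineq[of x v] by linarith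
    then show "\<exists>v. norm v \<le> M \<and> patch (shift v T) 0 R = patch P 0 R" using x(2) by auto
  qed
qed

text \<open>Two occurrences at a short distance \<open>z\<close> would place two copies of a tile of \<open>P\<close> at distance \<open>z\<close>
  inside one copy of the patch of \<open>P\<close>, hence inside \<open>P\<close>. The radius \<open>R\<close> exceeds the distance from the
  origin to a point of the tile by \<open>1\<close> to leave room for moving the tile by \<open>z\<close>.\<close>

lemma occurrences_separated:
  assumes P: "P \<in> \<Omega>"
  obtains R \<rho> where "0 < R" "0 < \<rho>"
    "\<And>S z. patch S 0 R = patch P 0 R \<Longrightarrow> patch (shift z S) 0 R = patch P 0 R \<Longrightarrow> norm z < \<rho> \<Longrightarrow> z = 0"
proof -
  obtain t where t: "t \<in> P" using tiling_space_pattern_nonempty[OF ts P] by blast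
  obtain q where q: "q \<in> fst t" using compact_tile[OF P t] unfolding compact_tile_def by blast
  obtain \<rho> where \<rho>: "0 < \<rho>" "\<And>z. norm z < \<rho> \<Longrightarrow> shift_tile z t \<in> P \<Longrightarrow> z = 0"
    using small_return_is_zero[OF P, of t] by metis
  let ?R = "norm q + 1"
  show thesis
  proof (rule that[of ?R "min \<rho> 1"])
    show "0 < ?R" by (simp add: add_nonneg_pos)
    fix S z assume S: "patch S 0 ?R = patch P 0 ?R" "patch (shift z S) 0 ?R = patch P 0 ?R"
      and z: "norm z < min \<rho> 1"
    have "t \<in> patch P 0 ?R" using t q by (auto simp: patch_def)
    then have "t \<in> shift z S" using S(2) patch_subset by blast
    then have "shift_tile (- z) t \<in> S" by (simp add: mem_shift_iff)
    moreover have "q + z \<in> fst (shift_tile (- z) t) \<inter> ball 0 ?R"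
      using q z norm_triangle_ineq[of q z] by (auto simp: fst_shift_tile)
    ultimately have "shift_tile (- z) t \<in> patch S 0 ?R" by (auto simp: patch_def)
    then have "shift_tile (- z) t \<in> P" using S(1) patch_subset by blast
    then show "z = 0" using \<rho>(2)[of "- z"] z by simp
  qed (use \<rho> in auto)
qed


lemma is_delone_occurrences:
  assumes "minimal \<Omega>" "P \<in> \<Omega>" "T \<in> \<Omega>" "0 < R" "0 < \<rho>"
    and sep: "\<And>S z. patch S 0 R = patch P 0 R \<Longrightarrow> patch (shift z S) 0 R = patch P 0 R \<Longrightarrow> norm z < \<rho> \<Longrightarrow> z = 0"
  shows "is_delone (occurrences R P T)"
  unfolding is_delone_def
proof (intro conjI ballI)
  show "is_point t" if "t \<in> occurrences R P T" for t using that by (auto simp: occurrences_def is_point_def)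
  show "\<exists>r>0. \<forall>p l q m. ({p}, l) \<in> occurrences R P T \<longrightarrow> ({q}, m) \<in> occurrences R P T \<longrightarrow> (p, l) \<noteq> (q, m) \<longrightarrow> r \<le> dist p q"
  proof (intro exI conjI allI impI)
    fix p q :: 'a and l m :: 'l
    assume *: "({p}, l) \<in> occurrences R P T" "({q}, m) \<in> occurrences R P T" "(p, l) \<noteq> (q, m)"
    then have "patch (shift p T) 0 R = patch P 0 R" "patch (shift (q - p) (shift p T)) 0 R = patch P 0 R"
      and "q - p \<noteq> 0"
      by (auto simp: mem_occurrences)
    then have "\<not> norm (q - p) < \<rho>" using sep by blast
    then show "\<rho> \<le> dist p q" by (simp add: dist_norm norm_minus_commute)
  qed (rule assms)
  obtain M where M: "0 < M" "\<And>T. T \<in> \<Omega> \<Longrightarrow> \<exists>v. norm v \<le> M \<and> patch (shift v T) 0 R = patch P 0 R"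
    using repetitive[OF assms(1,2,4)] by metis
  have "\<exists>p l. ({p}, l) \<in> occurrences R P T \<and> dist x p \<le> M" for x
  proof -
    obtain v where v: "norm v \<le> M" "patch (shift v (shift x T)) 0 R = patch P 0 R"
      using M(2)[of "shift x T"] assms(3) by auto
    show ?thesis
    proof (intro exI conjI)
      show "({v + x}, undefined) \<in> occurrences R P T" using v(2) by (simp add: mem_occurrences)
      show "dist x (v + x) \<le> M" using v(1) by (simp add: dist_norm)
    qed
  qed
  then show "\<exists>R'>0. \<forall>x. \<exists>p l. ({p}, l) \<in> occurrences R P T \<and> dist x p \<le> R'" using M(1) by blast
qed

lemma occurrences_local_derivation:
  assumes "0 < R"
  shows "local_derivation \<Omega> (occurrences R P ` \<Omega>) (occurrences R P)"
proof -
  have "continuous_map X (tiling_topology (occurrences R P ` \<Omega>)) (occurrences R P)"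
  proof (rule continuous_map_nearbyI)
    fix T and r \<delta> :: real assume T: "T \<in> topspace X" and "0 < r" "0 < \<delta>"
    show "\<exists>N. openin X N \<and> T \<in> N \<and> (\<forall>T'\<in>N. occurrences R P T' \<in> nearby (occurrences R P ` \<Omega>) (occurrences R P T) r \<delta>)"
    proof (intro exI conjI ballI)
      show "openin X (nearby \<Omega> T (R + r) \<delta>)" using T \<open>0 < r\<close> assms by (intro openin_nearby) auto
      show "T \<in> nearby \<Omega> T (R + r) \<delta>" using T \<open>0 < \<delta>\<close> by (intro center_in_nearby) auto
      fix T' assume "T' \<in> nearby \<Omega> T (R + r) \<delta>"
      then obtain x where x: "T' \<in> \<Omega>" "norm x < \<delta>" "patch (shift x T') 0 (R + r) = patch T 0 (R + r)"
        by (rule nearbyE)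
      show "occurrences R P T' \<in> nearby (occurrences R P ` \<Omega>) (occurrences R P T) r \<delta>"
        using occurrences_local[OF x(3), of P] x by (intro nearbyI[of _ _ x]) (auto simp: occurrences_shift)
    qed
  qed (auto intro: compact_tile_occurrences)
  moreover have "\<exists>R'>0. \<forall>T\<in>\<Omega>. \<forall>T'\<in>\<Omega>. patch T 0 R' = patch T' 0 R' \<longrightarrow>
      patch (occurrences R P T) 0 r = patch (occurrences R P T') 0 r" if "0 < r" for r
    using that assms occurrences_local[of _ R r] by (intro exI[of _ "R + r"]) auto
  ultimately show ?thesis by (auto simp: local_derivation_def factor_map_def occurrences_shift)
qed

lemma tiling_space_occurrences:
  assumes "0 < R" and del: "\<And>T. T \<in> \<Omega> \<Longrightarrow> is_delone (occurrences R P T)"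
  shows "tiling_space (occurrences R P ` \<Omega>)"
  unfolding tiling_space_def
proof (intro conjI)
  show "occurrences R P ` \<Omega> \<noteq> {}" using ts by (simp add: tiling_space_def)
  let ?K = "{({0}, undefined)} :: ('a, 'l) tile set"
  interpret K: Metric_space ?K tile_dist by (rule Metric_space_tile_dist) (simp add: compact_tile_def)
  have "compact_space K.mtopology"
    by (simp add: compact_space_def finite_imp_compactin)
  moreover have "\<forall>T\<in>occurrences R P ` \<Omega>. \<forall>t\<in>T. \<exists>k\<in>?K. \<exists>x. t = shift_tile x k"
  proof (intro ballI)
    fix T t assume "T \<in> occurrences R P ` \<Omega>" "t \<in> T"
    then obtain x where "t = ({x}, undefined)" by (auto simp: occurrences_def)
    then have "t = shift_tile (- x) ({0}, undefined)" by (simp add: shift_tile_def)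
    then show "\<exists>k\<in>?K. \<exists>x. t = shift_tile x k" by blast
  qed
  ultimately show "\<exists>K. (Ball K is_tile \<and> Ball (occurrences R P ` \<Omega>) is_tiling \<or>
      Ball K is_point \<and> Ball (occurrences R P ` \<Omega>) is_delone) \<and>
    compact_space (Metric_space.mtopology K tile_dist) \<and>
    (\<forall>T\<in>occurrences R P ` \<Omega>. \<forall>t\<in>T. \<exists>k\<in>K. \<exists>x. t = shift_tile x k)"
    using del by (intro exI[of _ ?K]) (auto simp: is_point_def)
  show "\<forall>T\<in>occurrences R P ` \<Omega>. \<forall>x. shift x T \<in> occurrences R P ` \<Omega>"
    by (auto simp flip: occurrences_shift)
  have "compactin (tiling_topology (occurrences R P ` \<Omega>)) (occurrences R P ` topspace X)"
    using compact_X occurrences_local_derivation[OF assms(1), of P] unfolding compact_space_def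
    by (intro image_compactin) (auto simp: local_derivation_def factor_map_def)
  then show "compact_space (tiling_topology (occurrences R P ` \<Omega>))" by (simp add: compact_space_def)
qed

text \<open>The transversal consists of the tilings that agree with \<open>P\<close> on a ball. Half the separation of
  the occurrences of this patch is a thickness for which the coordinates are unique.\<close>

lemma exists_open_flow_box:
  assumes min: "minimal \<Omega>" and P: "P \<in> \<Omega>"
  obtains \<Xi> \<epsilon> where "open_flow_box \<Omega> \<Xi> \<epsilon>" "P \<in> flow_box \<Xi> \<epsilon>"
proof -
  obtain R \<rho> where R: "0 < R" and \<rho>: "0 < \<rho>" and
    sep: "\<And>S z. patch S 0 R = patch P 0 R \<Longrightarrow> patch (shift z S) 0 R = patch P 0 R \<Longrightarrow> norm z < \<rho> \<Longrightarrow> z = 0"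
    using occurrences_separated[OF P] by metis
  have del: "is_delone (occurrences R P T)" if "T \<in> \<Omega>" for T
    using is_delone_occurrences[OF min P that R \<rho> sep] .
  define \<Xi> where "\<Xi> = {T \<in> \<Omega>. patch T 0 R = patch P 0 R}"
  have "\<Xi> = {T \<in> \<Omega>. occurrences R P T \<in> canonical_transversal (occurrences R P ` \<Omega>)}"
    by (auto simp: \<Xi>_def canonical_transversal_def mem_occurrences)
  then have tr: "FLC_transversal \<Omega> \<Xi>"
    using tiling_space_occurrences[OF R del] occurrences_local_derivation[OF R, of P] del
    unfolding FLC_transversal_def delone_space_def
    by (intro exI[of _ "occurrences R P ` \<Omega>"] exI[of _ "occurrences R P"]) simp
  have mem: "P \<in> flow_box \<Xi> (\<rho>/2)"
    unfolding flow_box_def mem_Collect_eq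
    using P \<rho> by (intro exI[of _ P] exI[of _ 0]) (simp add: \<Xi>_def)
  have "open_flow_box \<Omega> \<Xi> (\<rho>/2)"
    unfolding open_flow_box_def
  proof (intro conjI tr)
    show "0 < \<rho>/2" using \<rho> by simp
    show "inj_on (\<lambda>(S, x). shift x S) (\<Xi> \<times> ball 0 (\<rho>/2))"
    proof (rule inj_onI, clarsimp)
      fix S x S' x' assume S: "S \<in> \<Xi>" "S' \<in> \<Xi>" and x: "norm x * 2 < \<rho>" "norm x' * 2 < \<rho>"
        and eq: "shift x S = shift x' S'"
      from arg_cong[OF eq, of "shift (- x')"] have S': "S' = shift (x - x') S" by simp
      have "x - x' = 0"
      proof (rule sep)
        show "norm (x - x') < \<rho>" using norm_triangle_ineq4[of x x'] x by linarith
        show "patch S 0 R = patch P 0 R" using S(1) by (simp add: \<Xi>_def)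
        show "patch (shift (x - x') S) 0 R = patch P 0 R" using S(2) by (simp add: \<Xi>_def flip: S')
      qed
      then show "S = S' \<and> x = x'" using S' by simp
    qed
    show "openin X (flow_box \<Xi> (\<rho>/2))"
      unfolding openin_nearby_iff
    proof (intro conjI ballI)
      show "flow_box \<Xi> (\<rho>/2) \<subseteq> \<Omega>" by (auto simp: flow_box_def \<Xi>_def)
      fix T assume "T \<in> flow_box \<Xi> (\<rho>/2)"
      then obtain R' \<delta> where R': "0 < R'" "0 < \<delta>" and chart: "\<And>T' x. T' \<in> \<Omega> \<Longrightarrow> norm x < \<delta> \<Longrightarrow>
          patch (shift x T') 0 R' = patch T 0 R' \<Longrightarrow>
          \<exists>S\<in>\<Xi>. \<exists>S'\<in>\<Xi>. \<exists>a. T = shift a S \<and> T' = shift (a - x) S' \<and> norm a < \<rho>/2 \<and> norm (a - x) < \<rho>/2"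
        by (rule flow_box_chart[OF ts tr]) blast
      have "nearby \<Omega> T R' \<delta> \<subseteq> flow_box \<Xi> (\<rho>/2)"
      proof
        fix T' assume "T' \<in> nearby \<Omega> T R' \<delta>"
        then obtain x where x: "T' \<in> \<Omega>" "norm x < \<delta>" "patch (shift x T') 0 R' = patch T 0 R'"
          by (rule nearbyE)
        from chart[OF this] show "T' \<in> flow_box \<Xi> (\<rho>/2)" unfolding flow_box_def by blast
      qed
      then show "\<exists>R'>0. \<exists>\<delta>>0. nearby \<Omega> T R' \<delta> \<subseteq> flow_box \<Xi> (\<rho>/2)" using R' by blast
    qed
  qed
  then show thesis using mem by (rule that)
qed

text \<open>A small translation \<open>x\<close> changes both coordinates by \<open>-x\<close>, so it does not change their
  difference.\<close>

lemma flow_box_cocycle_is_cocycle: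
  assumes fb: "\<And>T. T \<in> \<Omega> \<Longrightarrow> open_flow_box \<Omega> (\<Xi> T) (\<epsilon> T) \<and> T \<in> flow_box (\<Xi> T) (\<epsilon> T)"
  shows "flow_box_cocycle (\<lambda>T v. v) \<Xi> \<epsilon> \<in> cech_cocycles X"
proof -
  let ?U = "\<lambda>T. flow_box (\<Xi> T) (\<epsilon> T)" and ?c = "\<lambda>T. box_coord (\<Xi> T) (\<epsilon> T)"
  have op: "openin X (?U T)" if "T \<in> \<Omega>" for T using fb[OF that] by (auto simp: open_flow_box_def)
  then have sub: "?U T \<subseteq> \<Omega>" if "T \<in> \<Omega>" for T using openin_subset[OF op[OF that]] by simp
  have "locally_constant_on X (?U T \<inter> ?U T') (\<lambda>S. ?c T S - ?c T' S)" if T: "T \<in> \<Omega>" "T' \<in> \<Omega>" for T T'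
  proof (subst locally_constant_on_iff)
    show "?U T \<inter> ?U T' \<subseteq> topspace X" using sub T by auto
    show "\<forall>S\<in>?U T \<inter> ?U T'. \<exists>N. openin X N \<and> S \<in> N \<and>
        (\<forall>S'\<in>N \<inter> (?U T \<inter> ?U T'). ?c T S' - ?c T' S' = ?c T S - ?c T' S)"
    proof
      fix S assume S: "S \<in> ?U T \<inter> ?U T'"
      then have S\<Omega>: "S \<in> \<Omega>" using sub T by blast
      obtain R \<delta> where R: "0 < R" "0 < \<delta>" and c: "\<And>S' x. S' \<in> \<Omega> \<Longrightarrow> norm x < \<delta> \<Longrightarrow>
          patch (shift x S') 0 R = patch S 0 R \<Longrightarrow> ?c T S' = ?c T S - x"
        using box_coord_chart[OF ts conjunct1[OF fb[OF T(1)]], of S] S by blast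
      obtain R' \<delta>' where R': "0 < R'" "0 < \<delta>'" and c': "\<And>S' x. S' \<in> \<Omega> \<Longrightarrow> norm x < \<delta>' \<Longrightarrow>
          patch (shift x S') 0 R' = patch S 0 R' \<Longrightarrow> ?c T' S' = ?c T' S - x"
        using box_coord_chart[OF ts conjunct1[OF fb[OF T(2)]], of S] S by blast
      let ?N = "nearby \<Omega> S (max R R') (min \<delta> \<delta>')"
      have "?c T S' - ?c T' S' = ?c T S - ?c T' S" if "S' \<in> ?N" for S'
      proof -
        obtain x where x: "S' \<in> \<Omega>" "norm x < min \<delta> \<delta>'"
          "patch (shift x S') 0 (max R R') = patch S 0 (max R R')"
          using \<open>S' \<in> ?N\<close> by (rule nearbyE)
        have "patch (shift x S') 0 R = patch S 0 R" "patch (shift x S') 0 R' = patch S 0 R'"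
          using agree_mono[OF x(3)] by simp_all
        then show ?thesis using c[OF x(1), of x] c'[OF x(1), of x] x(2) by simp
      qed
      moreover have "openin X ?N" "S \<in> ?N"
        using openin_nearby[OF S\<Omega>] center_in_nearby[OF S\<Omega>] R R' by auto
      ultimately show "\<exists>N. openin X N \<and> S \<in> N \<and>
        (\<forall>S'\<in>N \<inter> (?U T \<inter> ?U T'). ?c T S' - ?c T' S' = ?c T S - ?c T' S)" by blast
    qed
  qed
  then show ?thesis
    using fb op by (auto simp: flow_box_cocycle_def cech_cocycles_def point_cover_def)
qed

end

section \<open>Maps that are local up to displacement\<close>

text \<open>The assumption \<open>loc\<close> is stronger than continuity in that the same translation \<open>x\<close> appears in
  the hypothesis and in the conclusion.\<close>

locale displaced_local_map =
  O1: flc_space \<Omega>1 + O2: flc_space \<Omega>2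
  for \<Omega>1 :: "('a::euclidean_space, 'm::metric_space) pattern set"
  and \<Omega>2 :: "('a, 'n::metric_space) pattern set" +
  fixes \<phi> :: "('a, 'm) pattern \<Rightarrow> ('a, 'n) pattern"
  assumes maps: "T \<in> \<Omega>1 \<Longrightarrow> \<phi> T \<in> \<Omega>2"
    and loc: "T \<in> \<Omega>1 \<Longrightarrow> 0 < r \<Longrightarrow> \<exists>R>0. \<exists>\<delta>>0. \<forall>T'\<in>\<Omega>1. \<forall>x. norm x < \<delta> \<longrightarrow>
      patch (shift x T') 0 R = patch T 0 R \<longrightarrow> patch (shift x (\<phi> T')) 0 r = patch (\<phi> T) 0 r"
begin

lemma continuous: "continuous_map O1.X O2.X \<phi>"
proof (rule continuous_map_nearbyI[OF O2.compact_tile])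
  fix T and r \<delta> :: real assume T: "T \<in> topspace O1.X" and r: "0 < r" and \<delta>: "0 < \<delta>"
  obtain R \<delta>' where R: "0 < R" "0 < \<delta>'" and l: "\<And>T' x. T' \<in> \<Omega>1 \<Longrightarrow> norm x < \<delta>' \<Longrightarrow>
      patch (shift x T') 0 R = patch T 0 R \<Longrightarrow> patch (shift x (\<phi> T')) 0 r = patch (\<phi> T) 0 r"
    using loc[of T r] T r by auto
  show "\<exists>N. openin O1.X N \<and> T \<in> N \<and> (\<forall>T'\<in>N. \<phi> T' \<in> nearby \<Omega>2 (\<phi> T) r \<delta>)"
  proof (intro exI[of _ "nearby \<Omega>1 T R (min \<delta> \<delta>')"] conjI ballI)
    show "openin O1.X (nearby \<Omega>1 T R (min \<delta> \<delta>'))" using T R by (intro O1.openin_nearby) auto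
    show "T \<in> nearby \<Omega>1 T R (min \<delta> \<delta>')" using T R \<delta> by (intro center_in_nearby) auto
    fix T' assume "T' \<in> nearby \<Omega>1 T R (min \<delta> \<delta>')"
    then obtain x where x: "T' \<in> \<Omega>1" "norm x < min \<delta> \<delta>'" "patch (shift x T') 0 R = patch T 0 R"
      by (rule nearbyE)
    show "\<phi> T' \<in> nearby \<Omega>2 (\<phi> T) r \<delta>"
      using l[OF x(1) _ x(3)] x(2) by (intro nearbyI[OF maps[OF x(1)], of x]) auto
  qed
qed (auto intro: maps)

text \<open>Translating back the images along the orbit through \<open>T\<close> gives tilings \<open>G t\<close>. For each radius the
  patch of \<open>G t\<close> is locally constant in \<open>t\<close>, hence constant on the connected real line. The
  neighbourhoods of constancy may shrink as the radius grows, which does no harm.\<close>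

lemma equivariant:
  assumes T: "T \<in> \<Omega>1"
  shows "\<phi> (shift v T) = shift v (\<phi> T)"
proof -
  define G where "G t = shift (- (t *\<^sub>R v)) (\<phi> (shift (t *\<^sub>R v) T))" for t :: real
  have "G 1 = G 0"
  proof (rule pattern_eqI)
    have "G r \<in> \<Omega>2" for r using maps T by (simp add: G_def)
    then show "fst t \<noteq> {}" if "t \<in> G 1 \<union> G 0" for t
      using O2.compact_tile[of _ t] that unfolding compact_tile_def by blast
  next
    fix R :: real assume R: "0 < R"
    have "\<forall>\<^sub>F t in at t0 within UNIV. patch (G t0) 0 R = patch (G t) 0 R" for t0
    proof -
      let ?r = "R + norm (t0 *\<^sub>R v)"
      have r: "0 < ?r" using R by (simp add: add_pos_nonneg)
      obtain R' \<delta> where "0 < R'" "0 < \<delta>" and l: "\<And>T' x. T' \<in> \<Omega>1 \<Longrightarrow> norm x < \<delta> \<Longrightarrow>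
          patch (shift x T') 0 R' = patch (shift (t0 *\<^sub>R v) T) 0 R' \<Longrightarrow>
          patch (shift x (\<phi> T')) 0 ?r = patch (\<phi> (shift (t0 *\<^sub>R v) T)) 0 ?r"
        using loc[of "shift (t0 *\<^sub>R v) T" ?r] T r by auto
      have "((\<lambda>t. norm ((t0 - t) *\<^sub>R v)) \<longlongrightarrow> norm ((t0 - t0) *\<^sub>R v)) (at t0)"
        by (intro tendsto_intros)
      then have "\<forall>\<^sub>F t in at t0. norm ((t0 - t) *\<^sub>R v) < \<delta>"
        by (rule order_tendstoD) (simp add: \<open>0 < \<delta>\<close>)
      then show ?thesis
      proof eventually_elim
        case (elim t)
        have "shift ((t0 - t) *\<^sub>R v) (shift (t *\<^sub>R v) T) = shift (t0 *\<^sub>R v) T"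
          by (simp add: scaleR_diff_left)
        with l[of "shift (t *\<^sub>R v) T" "(t0 - t) *\<^sub>R v"] elim T
        have "patch (shift ((t0 - t) *\<^sub>R v) (\<phi> (shift (t *\<^sub>R v) T))) 0 ?r = patch (\<phi> (shift (t0 *\<^sub>R v) T)) 0 ?r"
          by simp
        from patch_shift_cong[OF this, of "- (t0 *\<^sub>R v)" R]
        show ?case by (simp add: G_def scaleR_diff_left)
      qed
    qed
    then show "patch (G 1) 0 R = patch (G 0) 0 R"
      by (intro connected_local_const[where f = "\<lambda>t. patch (G t) 0 R", OF connected_UNIV UNIV_I UNIV_I] ballI)
  qed
  then have "shift (- v) (\<phi> (shift v T)) = \<phi> T" by (simp add: G_def)
  from arg_cong[OF this, of "shift v"] show ?thesis by simp
qed

lemma surjective: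
  assumes "minimal \<Omega>2"
  shows "\<phi> ` \<Omega>1 = \<Omega>2"
proof
  show "\<phi> ` \<Omega>1 \<subseteq> \<Omega>2" using maps by blast
  obtain T where T: "T \<in> \<Omega>1" using O1.ts by (auto simp: tiling_space_def)
  have "compactin O2.X (\<phi> ` \<Omega>1)"
    using image_compactin[OF _ continuous, of \<Omega>1] O1.compact_X by (simp add: compact_space_def)
  then have "closedin O2.X (\<phi> ` \<Omega>1)" by (rule compactin_imp_closedin[OF O2.Hausdorff_X])
  moreover have "range (\<lambda>x. shift x (\<phi> T)) \<subseteq> \<phi> ` \<Omega>1"
    using equivariant[OF T] T by (auto simp flip: equivariant[OF T])
  ultimately have "O2.X closure_of (range (\<lambda>x. shift x (\<phi> T))) \<subseteq> \<phi> ` \<Omega>1" by (intro closure_of_minimal)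
  then show "\<Omega>2 \<subseteq> \<phi> ` \<Omega>1" using assms maps[OF T] by (auto simp: minimal_def)
qed

text \<open>The radius \<open>r + 1\<close> and the bound \<open>1\<close> on the translations leave room for undoing the translation.\<close>

lemma uniformly_local:
  assumes r: "0 < r"
  shows "\<exists>R>0. \<forall>T\<in>\<Omega>1. \<forall>T'\<in>\<Omega>1. patch T 0 R = patch T' 0 R \<longrightarrow> patch (\<phi> T) 0 r = patch (\<phi> T') 0 r"
proof -
  have "\<exists>R>0. \<exists>\<delta>>0. \<delta> \<le> 1 \<and> (\<forall>T'\<in>\<Omega>1. \<forall>x. norm x < \<delta> \<longrightarrow>
      patch (shift x T') 0 R = patch T 0 R \<longrightarrow> patch (shift x (\<phi> T')) 0 (r + 1) = patch (\<phi> T) 0 (r + 1))"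
    if "T \<in> \<Omega>1" for T
  proof -
    have "0 < r + 1" using r by simp
    from loc[OF that this] obtain R \<delta> where "0 < R" "0 < \<delta>" "\<forall>T'\<in>\<Omega>1. \<forall>x. norm x < \<delta> \<longrightarrow>
      patch (shift x T') 0 R = patch T 0 R \<longrightarrow> patch (shift x (\<phi> T')) 0 (r + 1) = patch (\<phi> T) 0 (r + 1)"
      by blast
    then show ?thesis by (intro exI[of _ R] conjI exI[of _ "min \<delta> 1"]) auto
  qed
  then obtain R \<delta> where R: "\<And>T. T \<in> \<Omega>1 \<Longrightarrow> 0 < R T" and \<delta>: "\<And>T. T \<in> \<Omega>1 \<Longrightarrow> 0 < \<delta> T \<and> \<delta> T \<le> 1"
    and l: "\<And>T T' x. T \<in> \<Omega>1 \<Longrightarrow> T' \<in> \<Omega>1 \<Longrightarrow> norm x < \<delta> T \<Longrightarrow>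
      patch (shift x T') 0 (R T) = patch T 0 (R T) \<Longrightarrow> patch (shift x (\<phi> T')) 0 (r + 1) = patch (\<phi> T) 0 (r + 1)"
    by metis
  define U where "U T = nearby \<Omega>1 T (R T) (\<delta> T)" for T
  have "\<forall>W\<in>U ` \<Omega>1. openin O1.X W" using O1.openin_nearby R by (auto simp: U_def)
  moreover have "\<Omega>1 \<subseteq> \<Union>(U ` \<Omega>1)" using center_in_nearby \<delta> by (fastforce simp: U_def)
  ultimately obtain F where F: "finite F" "F \<subseteq> U ` \<Omega>1" "\<Omega>1 \<subseteq> \<Union>F"
    using O1.compact_X unfolding compact_space_alt topspace_tiling_topology by meson
  obtain C where C: "finite C" "C \<subseteq> \<Omega>1" "\<Omega>1 \<subseteq> (\<Union>T\<in>C. U T)"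
    using finite_subset_image[OF F(1,2)] F(3) by blast
  define R0 where "R0 = Max (insert 0 (R ` C)) + 1"
  have R0: "R T + 1 \<le> R0" if "T \<in> C" for T
    unfolding R0_def using C(1) that by (simp add: Max_ge)
  have "0 \<le> Max (insert 0 (R ` C))" using C(1) by (intro Max_ge) auto
  then have "0 < R0" by (simp add: R0_def)
  moreover have "patch (\<phi> T) 0 r = patch (\<phi> T') 0 r"
    if T: "T \<in> \<Omega>1" "T' \<in> \<Omega>1" "patch T 0 R0 = patch T' 0 R0" for T T'
  proof -
    obtain S where S: "S \<in> C" "T \<in> U S" using C(3) T(1) by blast
    then have S1: "S \<in> \<Omega>1" using C(2) by blast
    from S(2) obtain x where x: "norm x < \<delta> S" "patch (shift x T) 0 (R S) = patch S 0 (R S)"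
      unfolding U_def by (rule nearbyE)
    have n: "norm x \<le> 1" using x(1) \<delta>[OF S1] by simp
    have "patch (shift x T') 0 (R S) = patch S 0 (R S)"
      using patch_shift_cong[OF T(3), of x "R S"] x(2) n R0[OF S(1)] by simp
    then have "patch (shift x (\<phi> T)) 0 (r + 1) = patch (shift x (\<phi> T')) 0 (r + 1)"
      using l[OF S1 T(1) x] l[OF S1 T(2) x(1)] by simp
    from patch_shift_cong[OF this, of "- x" r] n show ?thesis by simp
  qed
  ultimately show ?thesis by blast
qed

lemma local_derivation: "minimal \<Omega>2 \<Longrightarrow> local_derivation \<Omega>1 \<Omega>2 \<phi>"
  using continuous equivariant surjective uniformly_local
  by (auto simp: local_derivation_def factor_map_def)

end

section \<open>Cohomologous maps\<close>

locale cohomologous_maps =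
  O1: flc_space \<Omega>1 + O2: flc_space \<Omega>2
  for X :: "'x topology"
  and \<Omega>1 :: "('a::euclidean_space, 'm::metric_space) pattern set"
  and \<Omega>2 :: "('a, 'n::metric_space) pattern set" +
  fixes h1 :: "'x \<Rightarrow> ('a, 'm) pattern" and h2 :: "'x \<Rightarrow> ('a, 'n) pattern"
    and \<Xi>1 \<epsilon>1 \<Xi>2 \<epsilon>2
  assumes h1: "continuous_map X O1.X h1" and h2: "continuous_map X O2.X h2"
    and fb1: "T \<in> \<Omega>1 \<Longrightarrow> open_flow_box \<Omega>1 (\<Xi>1 T) (\<epsilon>1 T) \<and> T \<in> flow_box (\<Xi>1 T) (\<epsilon>1 T)"
    and fb2: "S \<in> \<Omega>2 \<Longrightarrow> open_flow_box \<Omega>2 (\<Xi>2 S) (\<epsilon>2 S) \<and> S \<in> flow_box (\<Xi>2 S) (\<epsilon>2 S)"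
    and rel: "(cocycle_pullback X h1 (flow_box_cocycle (\<lambda>T v. v) \<Xi>1 \<epsilon>1),
      cocycle_pullback X h2 (flow_box_cocycle (\<lambda>T v. v) \<Xi>2 \<epsilon>2)) \<in> cech_rel X"
begin

lemma h1_in: "p \<in> topspace X \<Longrightarrow> h1 p \<in> \<Omega>1"
  using h1 by (auto simp: continuous_map_def)

lemma h2_in: "p \<in> topspace X \<Longrightarrow> h2 p \<in> \<Omega>2"
  using h2 by (auto simp: continuous_map_def)

text \<open>The function \<open>s\<close> is glued from \<open>c1 p q - c2 p q - \<sigma> p q\<close> (for \<open>q\<close> near \<open>p\<close>); the cohomology relation is
  exactly the condition that these local functions agree on overlaps. The conclusion expresses how
  \<open>s\<close> changes when \<open>h1 q\<close> and \<open>h2 q\<close> are small displacements of \<open>h1 p\<close> and \<open>h2 p\<close>: the coordinates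
  change by \<open>-x\<close> and \<open>-y\<close>, and \<open>\<sigma> p\<close> does not change.\<close>

lemma displacement_exists:
  obtains s where "\<And>p. p \<in> topspace X \<Longrightarrow> \<exists>W R \<delta>. openin X W \<and> p \<in> W \<and> 0 < R \<and> 0 < \<delta> \<and>
    (\<forall>q\<in>W. \<forall>x y. norm x < \<delta> \<longrightarrow> norm y < \<delta> \<longrightarrow> patch (shift x (h1 q)) 0 R = patch (h1 p) 0 R \<longrightarrow>
      patch (shift y (h2 q)) 0 R = patch (h2 p) 0 R \<longrightarrow> s q = s p - x + y)"
proof -
  define c1 where "c1 p q = box_coord (\<Xi>1 (h1 p)) (\<epsilon>1 (h1 p)) (h1 q)" for p q
  define c2 where "c2 p q = box_coord (\<Xi>2 (h2 p)) (\<epsilon>2 (h2 p)) (h2 q)" for p q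
  obtain W \<sigma> where W: "point_cover X W"
    and \<sigma>: "\<And>p. p \<in> topspace X \<Longrightarrow> locally_constant_on X (W p) (\<sigma> p)"
    and eq: "\<And>p q z. p \<in> topspace X \<Longrightarrow> q \<in> topspace X \<Longrightarrow> z \<in> W p \<Longrightarrow> z \<in> W q \<Longrightarrow>
      (c1 p z - c1 q z) - (c2 p z - c2 q z) = \<sigma> p z - \<sigma> q z"
  proof -
    from rel obtain W \<sigma> where "point_cover X W" "\<forall>p\<in>topspace X. locally_constant_on X (W p) (\<sigma> p)"
      "\<forall>p\<in>topspace X. \<forall>q\<in>topspace X. \<forall>z\<in>W p \<inter> W q.
        (c1 p z - c1 q z) - (c2 p z - c2 q z) = \<sigma> p z - \<sigma> q z"
      unfolding cech_rel_def cocycle_pullback_def flow_box_cocycle_def c1_def c2_def by auto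
    then show thesis by (intro that[of W \<sigma>]) auto
  qed
  define s where "s p = c1 p p - c2 p p - \<sigma> p p" for p
  have s: "s q = c1 p q - c2 p q - \<sigma> p q" if "p \<in> topspace X" "q \<in> W p" for p q
  proof -
    have q: "q \<in> topspace X" using point_cover_subset[OF W that(1)] that(2) by blast
    then have "q \<in> W q" using W by (auto simp: point_cover_def)
    from eq[OF that(1) q that(2) this] show ?thesis by (simp add: s_def algebra_simps)
  qed
  show thesis
  proof (rule that[of s])
    fix p assume p: "p \<in> topspace X"
    have pW: "p \<in> W p" "openin X (W p)" using W p by (auto simp: point_cover_def)
    obtain N where N: "openin X N" "p \<in> N" "\<forall>q\<in>N \<inter> W p. \<sigma> p q = \<sigma> p p"
      using \<sigma>[OF p] pW(1) unfolding locally_constant_on_iff[OF point_cover_subset[OF W p]] by blast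
    obtain R1 \<delta>1 where R1: "0 < R1" "0 < \<delta>1" and k1: "\<And>T x. T \<in> \<Omega>1 \<Longrightarrow> norm x < \<delta>1 \<Longrightarrow>
        patch (shift x T) 0 R1 = patch (h1 p) 0 R1 \<Longrightarrow>
        box_coord (\<Xi>1 (h1 p)) (\<epsilon>1 (h1 p)) T = box_coord (\<Xi>1 (h1 p)) (\<epsilon>1 (h1 p)) (h1 p) - x"
      using box_coord_chart[OF O1.ts conjunct1[OF fb1[OF h1_in[OF p]]] conjunct2[OF fb1[OF h1_in[OF p]]]]
      by blast
    obtain R2 \<delta>2 where R2: "0 < R2" "0 < \<delta>2" and k2: "\<And>T x. T \<in> \<Omega>2 \<Longrightarrow> norm x < \<delta>2 \<Longrightarrow>
        patch (shift x T) 0 R2 = patch (h2 p) 0 R2 \<Longrightarrow>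
        box_coord (\<Xi>2 (h2 p)) (\<epsilon>2 (h2 p)) T = box_coord (\<Xi>2 (h2 p)) (\<epsilon>2 (h2 p)) (h2 p) - x"
      using box_coord_chart[OF O2.ts conjunct1[OF fb2[OF h2_in[OF p]]] conjunct2[OF fb2[OF h2_in[OF p]]]]
      by blast
    show "\<exists>W R \<delta>. openin X W \<and> p \<in> W \<and> 0 < R \<and> 0 < \<delta> \<and>
      (\<forall>q\<in>W. \<forall>x y. norm x < \<delta> \<longrightarrow> norm y < \<delta> \<longrightarrow> patch (shift x (h1 q)) 0 R = patch (h1 p) 0 R \<longrightarrow>
        patch (shift y (h2 q)) 0 R = patch (h2 p) 0 R \<longrightarrow> s q = s p - x + y)"
    proof (rule exI[of _ "N \<inter> W p"], rule exI[of _ "max R1 R2"], rule exI[of _ "min \<delta>1 \<delta>2"],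
        intro conjI ballI allI impI)
      fix q x y assume q: "q \<in> N \<inter> W p" and x: "norm x < min \<delta>1 \<delta>2" and y: "norm y < min \<delta>1 \<delta>2"
        and e1: "patch (shift x (h1 q)) 0 (max R1 R2) = patch (h1 p) 0 (max R1 R2)"
        and e2: "patch (shift y (h2 q)) 0 (max R1 R2) = patch (h2 p) 0 (max R1 R2)"
      have qX: "q \<in> topspace X" using openin_subset[OF N(1)] q by blast
      have "c1 p q = c1 p p - x" unfolding c1_def
        using x by (intro k1 h1_in[OF qX] agree_mono[OF e1]) auto
      moreover have "c2 p q = c2 p p - y" unfolding c2_def
        using y by (intro k2 h2_in[OF qX] agree_mono[OF e2]) auto
      moreover have "\<sigma> p q = \<sigma> p p" using N(3) q by blast
      ultimately show "s q = s p - x + y"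
        using s[OF p, of q] q by (simp add: s_def)
    qed (use N pW R1 R2 in auto)
  qed
qed

text \<open>Let \<open>h2 q\<close> agree with \<open>h2 p\<close> after the translation \<open>y\<close>. Since \<open>s q = s p - x + y\<close>, translating by
  \<open>s q\<close> replaces the displacement \<open>y\<close> of \<open>h2 q\<close> by the displacement \<open>x\<close> of \<open>h1 q\<close>.\<close>

lemma displaced_map:
  obtains s where "continuous_map X euclidean s"
    "\<And>p r. p \<in> topspace X \<Longrightarrow> 0 < r \<Longrightarrow> \<exists>W R \<delta>. openin X W \<and> p \<in> W \<and> 0 < R \<and> 0 < \<delta> \<and>
      (\<forall>q\<in>W. \<forall>x. norm x < \<delta> \<longrightarrow> patch (shift x (h1 q)) 0 R = patch (h1 p) 0 R \<longrightarrow>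
        patch (shift x (shift (s q) (h2 q))) 0 r = patch (shift (s p) (h2 p)) 0 r)"
proof -
  obtain s where s: "\<And>p. p \<in> topspace X \<Longrightarrow> \<exists>W R \<delta>. openin X W \<and> p \<in> W \<and> 0 < R \<and> 0 < \<delta> \<and>
    (\<forall>q\<in>W. \<forall>x y. norm x < \<delta> \<longrightarrow> norm y < \<delta> \<longrightarrow> patch (shift x (h1 q)) 0 R = patch (h1 p) 0 R \<longrightarrow>
      patch (shift y (h2 q)) 0 R = patch (h2 p) 0 R \<longrightarrow> s q = s p - x + y)"
    by (rule displacement_exists) blast
  define near1 where "near1 p R \<delta> = {q \<in> topspace X. h1 q \<in> nearby \<Omega>1 (h1 p) R \<delta>}" for p R \<delta>
  define near2 where "near2 p R \<delta> = {q \<in> topspace X. h2 q \<in> nearby \<Omega>2 (h2 p) R \<delta>}" for p R \<delta>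
  have near1: "openin X (near1 p R \<delta>)" "p \<in> near1 p R \<delta>" if "p \<in> topspace X" "0 < R" "0 < \<delta>" for p R \<delta>
    unfolding near1_def using that center_in_nearby[OF h1_in]
    by (auto intro: openin_continuous_map_preimage[OF h1 O1.openin_nearby[OF h1_in]])
  have near2: "openin X (near2 p R \<delta>)" "p \<in> near2 p R \<delta>" if "p \<in> topspace X" "0 < R" "0 < \<delta>" for p R \<delta>
    unfolding near2_def using that center_in_nearby[OF h2_in]
    by (auto intro: openin_continuous_map_preimage[OF h2 O2.openin_nearby[OF h2_in]])
  show thesis
  proof (rule that[of s])
    have "\<exists>U. openin X U \<and> p \<in> U \<and> (\<forall>q\<in>U. dist (s p) (s q) < e)" if p: "p \<in> topspace X" and e: "0 < e" for p e
    proof -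
      obtain W R \<delta> where W: "openin X W" "p \<in> W" "0 < R" "0 < \<delta>"
        and k: "\<And>q x y. q \<in> W \<Longrightarrow> norm x < \<delta> \<Longrightarrow> norm y < \<delta> \<Longrightarrow> patch (shift x (h1 q)) 0 R = patch (h1 p) 0 R \<Longrightarrow>
          patch (shift y (h2 q)) 0 R = patch (h2 p) 0 R \<Longrightarrow> s q = s p - x + y"
        using s[OF p] by metis
      let ?d = "min \<delta> (e/2)"
      have d: "0 < ?d" using W e by simp
      let ?U = "W \<inter> near1 p R ?d \<inter> near2 p R ?d"
      have "dist (s p) (s q) < e" if "q \<in> ?U" for q
      proof -
        from that have q: "q \<in> W" "h1 q \<in> nearby \<Omega>1 (h1 p) R ?d" "h2 q \<in> nearby \<Omega>2 (h2 p) R ?d"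
          by (auto simp: near1_def near2_def)
        obtain x where x: "norm x < ?d" "patch (shift x (h1 q)) 0 R = patch (h1 p) 0 R"
          using q(2) by (rule nearbyE)
        obtain y where y: "norm y < ?d" "patch (shift y (h2 q)) 0 R = patch (h2 p) 0 R"
          using q(3) by (rule nearbyE)
        have "dist (s p) (s q) = norm (x - y)" using k[OF q(1) _ _ x(2) y(2)] x(1) y(1) by (simp add: dist_norm)
        also have "\<dots> < e" using norm_triangle_ineq4[of x y] x(1) y(1) by simp
        finally show ?thesis .
      qed
      then show ?thesis using W near1[OF p W(3) d] near2[OF p W(3) d] by (intro exI[of _ ?U]) auto
    qed
    then show "continuous_map X euclidean s"
      using Met_TC.continuous_map_to_metric[of X s] by simp
  next
    fix p and r :: real assume p: "p \<in> topspace X" and r: "0 < r"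
    obtain W R \<delta> where W: "openin X W" "p \<in> W" "0 < R" "0 < \<delta>"
      and k: "\<And>q x y. q \<in> W \<Longrightarrow> norm x < \<delta> \<Longrightarrow> norm y < \<delta> \<Longrightarrow> patch (shift x (h1 q)) 0 R = patch (h1 p) 0 R \<Longrightarrow>
        patch (shift y (h2 q)) 0 R = patch (h2 p) 0 R \<Longrightarrow> s q = s p - x + y"
      using s[OF p] by metis
    let ?R = "max R (norm (s p) + r)"
    have R: "0 < ?R" using W by simp
    show "\<exists>W R \<delta>. openin X W \<and> p \<in> W \<and> 0 < R \<and> 0 < \<delta> \<and>
      (\<forall>q\<in>W. \<forall>x. norm x < \<delta> \<longrightarrow> patch (shift x (h1 q)) 0 R = patch (h1 p) 0 R \<longrightarrow>
        patch (shift x (shift (s q) (h2 q))) 0 r = patch (shift (s p) (h2 p)) 0 r)"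
    proof (rule exI[of _ "W \<inter> near2 p ?R \<delta>"], rule exI[of _ R], rule exI[of _ \<delta>],
        intro conjI ballI allI impI)
      fix q x assume q: "q \<in> W \<inter> near2 p ?R \<delta>" and x: "norm x < \<delta>" "patch (shift x (h1 q)) 0 R = patch (h1 p) 0 R"
      from q have "h2 q \<in> nearby \<Omega>2 (h2 p) ?R \<delta>" by (simp add: near2_def)
      then obtain y where y: "norm y < \<delta>" "patch (shift y (h2 q)) 0 ?R = patch (h2 p) 0 ?R" by (rule nearbyE)
      have "s q = s p - x + y" using k[of q x y] q x y(1) agree_mono[OF y(2), of R] by simp
      then have "shift x (shift (s q) (h2 q)) = shift (s p) (shift y (h2 q))" by (simp add: algebra_simps)
      then show "patch (shift x (shift (s q) (h2 q))) 0 r = patch (shift (s p) (h2 p)) 0 r"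
        using patch_shift_cong[OF y(2), of "s p" r] by simp
    qed (use W near2[OF p R W(4)] in auto)
  qed
qed

lemma homotopic_to_displacement:
  assumes s: "continuous_map X euclidean s"
  shows "homotopic_with (\<lambda>_. True) X O2.X h2 (\<lambda>p. shift (s p) (h2 p))"
proof -
  let ?I = "subtopology euclideanreal {0..1}"
  have 1: "continuous_map (prod_topology ?I X) euclidean (\<lambda>z. fst z *\<^sub>R s (snd z))"
  proof -
    have "continuous_map (prod_topology ?I X) euclidean fst"
      by (rule continuous_map_into_fulltopology[OF continuous_map_fst])
    moreover have "continuous_map (prod_topology ?I X) euclidean (\<lambda>z. s (snd z))"
      using continuous_map_compose[OF continuous_map_snd s] by (simp add: o_def)
    ultimately have *: "continuous_map (prod_topology ?I X) euclidean (\<lambda>z. (fst z, s (snd z)))"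
      unfolding prod_topology_euclidean[symmetric] by (rule continuous_map_pairedI)
    have "continuous_on UNIV (\<lambda>w :: real \<times> 'a. fst w *\<^sub>R snd w)" by (intro continuous_intros)
    then have "continuous_map euclidean euclidean (\<lambda>w :: real \<times> 'a. fst w *\<^sub>R snd w)" by simp
    from continuous_map_compose[OF * this] show ?thesis by (simp add: o_def)
  qed
  have 2: "continuous_map (prod_topology ?I X) O2.X (\<lambda>z. h2 (snd z))"
    using continuous_map_compose[OF continuous_map_snd h2] by (simp add: o_def)
  have "continuous_map (prod_topology ?I X) (prod_topology euclidean O2.X) (\<lambda>z. (fst z *\<^sub>R s (snd z), h2 (snd z)))"
    using 1 2 by (rule continuous_map_pairedI)
  from continuous_map_compose[OF this O2.continuous_map_shift]
  have "continuous_map (prod_topology ?I X) O2.X (\<lambda>z. shift (fst z *\<^sub>R s (snd z)) (h2 (snd z)))"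
    by (simp add: o_def)
  then show ?thesis
    unfolding homotopic_with_def by (intro exI[of _ "\<lambda>z. shift (fst z *\<^sub>R s (snd z)) (h2 (snd z))"]) simp
qed

theorem homotopic_to_local_derivation:
  assumes min: "minimal \<Omega>2" and g: "homeomorphic_maps X O1.X h1 g"
  shows "\<exists>\<phi>. local_derivation \<Omega>1 \<Omega>2 \<phi> \<and> homotopic_with (\<lambda>_. True) X O2.X h2 (\<phi> \<circ> h1)"
proof -
  obtain s where s: "continuous_map X euclidean s"
    and loc: "\<And>p r. p \<in> topspace X \<Longrightarrow> 0 < r \<Longrightarrow> \<exists>W R \<delta>. openin X W \<and> p \<in> W \<and> 0 < R \<and> 0 < \<delta> \<and>
      (\<forall>q\<in>W. \<forall>x. norm x < \<delta> \<longrightarrow> patch (shift x (h1 q)) 0 R = patch (h1 p) 0 R \<longrightarrow>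
        patch (shift x (shift (s q) (h2 q))) 0 r = patch (shift (s p) (h2 p)) 0 r)"
    by (rule displaced_map) blast
  define \<psi> where "\<psi> p = shift (s p) (h2 p)" for p
  have gc: "continuous_map O1.X X g" and gh: "\<And>p. p \<in> topspace X \<Longrightarrow> g (h1 p) = p"
    and hg: "\<And>T. T \<in> \<Omega>1 \<Longrightarrow> h1 (g T) = T"
    using g by (auto simp: homeomorphic_maps_def)
  have g_in: "g T \<in> topspace X" if "T \<in> \<Omega>1" for T using gc that by (auto simp: continuous_map_def)
  interpret \<phi>: displaced_local_map \<Omega>1 \<Omega>2 "\<psi> \<circ> g"
  proof unfold_locales
    show "(\<psi> \<circ> g) T \<in> \<Omega>2" if "T \<in> \<Omega>1" for T using h2_in[OF g_in[OF that]] by (simp add: \<psi>_def)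
    fix T and r :: real assume T: "T \<in> \<Omega>1" and r: "0 < r"
    obtain W R \<delta> where W: "openin X W" "g T \<in> W" and R: "0 < R" "0 < \<delta>"
      and k: "\<And>q x. q \<in> W \<Longrightarrow> norm x < \<delta> \<Longrightarrow> patch (shift x (h1 q)) 0 R = patch T 0 R \<Longrightarrow>
        patch (shift x (\<psi> q)) 0 r = patch (\<psi> (g T)) 0 r"
      using loc[OF g_in[OF T] r] unfolding \<psi>_def hg[OF T] by metis
    have "openin O1.X {T' \<in> topspace O1.X. g T' \<in> W}" using gc W(1) by (rule openin_continuous_map_preimage)
    then obtain R' \<delta>' where R': "0 < R'" "0 < \<delta>'" "nearby \<Omega>1 T R' \<delta>' \<subseteq> {T' \<in> topspace O1.X. g T' \<in> W}"
      unfolding O1.openin_nearby_iff using T W(2) by auto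
    show "\<exists>R>0. \<exists>\<delta>>0. \<forall>T'\<in>\<Omega>1. \<forall>x. norm x < \<delta> \<longrightarrow> patch (shift x T') 0 R = patch T 0 R \<longrightarrow>
        patch (shift x ((\<psi> \<circ> g) T')) 0 r = patch ((\<psi> \<circ> g) T) 0 r"
    proof (rule exI[of _ "max R R'"], rule conjI, (use R in force), rule exI[of _ "min \<delta> \<delta>'"],
        intro conjI ballI allI impI)
      fix T' x assume T': "T' \<in> \<Omega>1" and x: "norm x < min \<delta> \<delta>'"
        and e: "patch (shift x T') 0 (max R R') = patch T 0 (max R R')"
      have "T' \<in> nearby \<Omega>1 T R' \<delta>'"
        using x agree_mono[OF e, of R'] by (intro nearbyI[OF T', of x]) auto
      then have "g T' \<in> W" using R'(3) by blast
      then show "patch (shift x ((\<psi> \<circ> g) T')) 0 r = patch ((\<psi> \<circ> g) T) 0 r"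
        using k[of "g T'" x] x agree_mono[OF e, of R] hg[OF T'] by simp
    qed (use R R' in auto)
  qed
  have "homotopic_with (\<lambda>_. True) X O2.X h2 (\<psi> \<circ> g \<circ> h1)"
    using homotopic_to_displacement[OF s] gh
    by (auto intro: homotopic_with_eq simp: \<psi>_def)
  then show ?thesis using \<phi>.local_derivation[OF min] by blast
qed

end

text \<open>The flow boxes of \<open>\<Omega>1\<close> provide an element of the common class. It lies in the class of \<open>h2\<close>, so it
  is cohomologous to the pullback of the cocycle of some cover of \<open>\<Omega>2\<close> by flow boxes.\<close>

theorem theorem1p6:
  fixes \<Omega> :: "('a::euclidean_space, 'l::metric_space) pattern set"
    and \<Omega>1 :: "('a, 'm::metric_space) pattern set"
    and \<Omega>2 :: "('a, 'n::metric_space) pattern set"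
    and h1 :: "('a, 'l) pattern \<Rightarrow> ('a, 'm) pattern"
    and h2 :: "('a, 'l) pattern \<Rightarrow> ('a, 'n) pattern"
  assumes "tiling_space \<Omega>" "minimal \<Omega>" "aperiodic \<Omega>" "FLC \<Omega>"
    and "tiling_space \<Omega>1" "minimal \<Omega>1" "aperiodic \<Omega>1" "FLC \<Omega>1"
    and "tiling_space \<Omega>2" "minimal \<Omega>2" "aperiodic \<Omega>2" "FLC \<Omega>2"
    and "homeomorphic_map (tiling_topology \<Omega>) (tiling_topology \<Omega>1) h1"
    and "continuous_map (tiling_topology \<Omega>) (tiling_topology \<Omega>2) h2"
    and "map_class \<Omega> \<Omega>1 h1 = map_class \<Omega> \<Omega>2 h2"
  shows "\<exists>\<phi>. local_derivation \<Omega>1 \<Omega>2 \<phi> \<and>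
           homotopic_with (\<lambda>_. True) (tiling_topology \<Omega>) (tiling_topology \<Omega>2) h2 (\<phi> \<circ> h1)"
proof -
  let ?X = "tiling_topology \<Omega>"
  interpret O1: flc_space \<Omega>1 using assms by unfold_locales
  interpret O2: flc_space \<Omega>2 using assms by unfold_locales
  obtain g where g: "homeomorphic_maps ?X O1.X h1 g"
    using assms(13) homeomorphic_map_maps by blast
  then have h1: "continuous_map ?X O1.X h1" by (simp add: homeomorphic_maps_def)
  have "\<exists>\<Xi> \<epsilon>. open_flow_box \<Omega>1 \<Xi> \<epsilon> \<and> T \<in> flow_box \<Xi> \<epsilon>" if "T \<in> \<Omega>1" for T
    using O1.exists_open_flow_box[OF assms(6) that] by metis
  then obtain \<Xi>1 \<epsilon>1 where fb1: "\<And>T. T \<in> \<Omega>1 \<Longrightarrow> open_flow_box \<Omega>1 (\<Xi>1 T) (\<epsilon>1 T) \<and> T \<in> flow_box (\<Xi>1 T) (\<epsilon>1 T)"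
    by metis
  let ?c1 = "flow_box_cocycle (\<lambda>T v. v) \<Xi>1 \<epsilon>1"
  have c1: "?c1 \<in> cech_cocycles O1.X" by (rule O1.flow_box_cocycle_is_cocycle[OF fb1])
  have "?c1 \<in> fundamental_class \<Omega>1"
    unfolding fundamental_class_def strong_to_cech_def
    using equiv_class_self[OF equiv_cech_rel c1] fb1 by blast
  moreover have "cocycle_pullback ?X h1 ?c1 \<in> cech_rel ?X `` {cocycle_pullback ?X h1 ?c1}"
    by (rule equiv_class_self[OF equiv_cech_rel cocycle_pullback_in[OF h1 c1]])
  ultimately have "cocycle_pullback ?X h1 ?c1 \<in> map_class \<Omega> \<Omega>2 h2"
    unfolding assms(15)[symmetric] unfolding map_class_def cech_pullback_def by blast
  then obtain c where c: "c \<in> fundamental_class \<Omega>2"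
    and c_rel: "(cocycle_pullback ?X h2 c, cocycle_pullback ?X h1 ?c1) \<in> cech_rel ?X"
    unfolding map_class_def cech_pullback_def by blast
  from c obtain \<Xi>2 \<epsilon>2 where fb2: "\<And>T. T \<in> \<Omega>2 \<Longrightarrow> open_flow_box \<Omega>2 (\<Xi>2 T) (\<epsilon>2 T) \<and> T \<in> flow_box (\<Xi>2 T) (\<epsilon>2 T)"
    and c2: "(flow_box_cocycle (\<lambda>T v. v) \<Xi>2 \<epsilon>2, c) \<in> cech_rel O2.X"
    unfolding fundamental_class_def strong_to_cech_def by auto
  have equiv: "equiv (cech_cocycles ?X) (cech_rel ?X :: (((('a, 'l) pattern, 'a) cech_cochain) \<times> _) set)"
    by (rule equiv_cech_rel)
  have "(cocycle_pullback ?X h2 (flow_box_cocycle (\<lambda>T v. v) \<Xi>2 \<epsilon>2), cocycle_pullback ?X h1 ?c1) \<in> cech_rel ?X"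
    using cocycle_pullback_rel[OF assms(14) c2] c_rel equiv by (meson equivE transD)
  then have "(cocycle_pullback ?X h1 ?c1, cocycle_pullback ?X h2 (flow_box_cocycle (\<lambda>T v. v) \<Xi>2 \<epsilon>2)) \<in> cech_rel ?X"
    using equiv by (meson equivE symD)
  then interpret cohomologous_maps ?X \<Omega>1 \<Omega>2 h1 h2 \<Xi>1 \<epsilon>1 \<Xi>2 \<epsilon>2
    using h1 assms(14) fb1 fb2 by unfold_locales auto
  show ?thesis by (rule homotopic_to_local_derivation[OF assms(10) g])
qed

end
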